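(* Let $n\geq 9$ and let $\rho_0,\ldots,\rho_{n-3}\in S_n$ be involutions whose permutation representation graph is of type (A), (B) or (C) described in the context, and let $\Gamma_i=\langle\rho_j : j\neq i\rangle$. Then the coset geometry $\Gamma(S_n;(\Gamma_i)_{i\in\{0,\ldots,n-3\}})$ is flag-transitive.
   Context: The permutation representation graph has vertex set $\{1,\ldots,n\}$ and an $i$-edge $\{a,b\}$ whenever $a\rho_i=b\neq a$. The types: let $T$ be a tree with $n-3$ vertices in $\{1,\ldots,n\}$ whose $n-4$ edges are labelled bijectively by $2,\ldots,n-3$, $\rho_k$ ($k\geq2$) being the transposition of the endpoints of the $k$-edge; $t$ a leaf of $T$ whose incident edge has label $2$; $a_1,a_2,a_3$ the points not in $T$. Type (A): $\rho_0=(a_2\,a_3)$, $\rho_1=(a_1\,a_2)(a_3\,t)$. Type (B): $\rho_0=(a_2\,t)$, $\rho_1=(a_1\,a_2)(t\,a_3)$. Type (C): $\rho_0=(a_1\,a_2)(a_3\,t)$, $\rho_1=(a_1\,a_3)(a_2\,t)$. (Such involutions generate $S_n$.) Coset geometry $\Gamma(G;(G_i)_{i\in I})$: elements are the cosets $G_ig$ ($g\in G$, $i\in I$), of type $i$, with $G_ig_1$ and $G_jg_2$ incident iff $G_ig_1\cap G_jg_2\neq\emptyset$; $G$ acts by right multiplication. A flag is a set of pairwise incident elements, its type being the set of types of its elements. The geometry is flag-transitive if $G$ acts transitively on the set of flags of type $J$ for every $J\subseteq I$. *)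

theory Defs
  imports "HOL-Algebra.Sym_Groups"
begin

section \<open>Coset geometries\<close>

text \<open>
  An element is a coset tagged with its type, so that elements of different types are
  different even when the underlying cosets coincide as sets.
\<close>

definition coset_elements ::
    "('a, 'b) monoid_scheme \<Rightarrow> ('i \<Rightarrow> 'a set) \<Rightarrow> 'i set \<Rightarrow> ('i \<times> 'a set) set" where
  "coset_elements G H I = {(i, H i #>\<^bsub>G\<^esub> g) | i g. i \<in> I \<and> g \<in> carrier G}"

definition coset_incident :: "'i \<times> 'a set \<Rightarrow> 'i \<times> 'a set \<Rightarrow> bool" where
  "coset_incident x y \<longleftrightarrow> snd x \<inter> snd y \<noteq> {}"

definition coset_flag ::
    "('a, 'b) monoid_scheme \<Rightarrow> ('i \<Rightarrow> 'a set) \<Rightarrow> 'i set \<Rightarrow> ('i \<times> 'a set) set \<Rightarrow> bool" where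
  "coset_flag G H I F \<longleftrightarrow>
     F \<subseteq> coset_elements G H I \<and> (\<forall>x\<in>F. \<forall>y\<in>F. coset_incident x y)"

definition flag_type :: "('i \<times> 'a set) set \<Rightarrow> 'i set" where
  "flag_type F = fst ` F"

definition flag_act ::
    "('a, 'b) monoid_scheme \<Rightarrow> ('i \<times> 'a set) set \<Rightarrow> 'a \<Rightarrow> ('i \<times> 'a set) set" where
  "flag_act G F g = (\<lambda>(i, C). (i, C #>\<^bsub>G\<^esub> g)) ` F"

definition flag_transitive ::
    "('a, 'b) monoid_scheme \<Rightarrow> ('i \<Rightarrow> 'a set) \<Rightarrow> 'i set \<Rightarrow> bool" where
  "flag_transitive G H I \<longleftrightarrow>
     (\<forall>J\<subseteq>I. \<forall>F F'.
        coset_flag G H I F \<and> flag_type F = J \<and> coset_flag G H I F' \<and> flag_type F' = J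
        \<longrightarrow> (\<exists>g\<in>carrier G. flag_act G F g = F'))"

section \<open>Trees\<close>

text \<open>
  A simple graph is a vertex set with a set of two-element sets of vertices.  (The
  \<open>tree\<close> of the entry Graph_Theory concerns directed graphs: its acyclicity
  condition counts \<open>a, b, a\<close> as a cycle of a symmetric digraph.)
\<close>

definition simple_graph :: "'v set \<Rightarrow> 'v set set \<Rightarrow> bool" where
  "simple_graph V E \<longleftrightarrow> finite V \<and> (\<forall>f\<in>E. f \<subseteq> V \<and> card f = 2)"

definition graph_connected :: "'v set \<Rightarrow> 'v set set \<Rightarrow> bool" where
  "graph_connected V E \<longleftrightarrow>
     V \<noteq> {} \<and> (\<forall>u\<in>V. \<forall>v\<in>V. (u, v) \<in> {(x, y). {x, y} \<in> E}\<^sup>*)"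

definition graph_cycle :: "'v set set \<Rightarrow> 'v list \<Rightarrow> bool" where
  "graph_cycle E vs \<longleftrightarrow>
     length vs \<ge> 3 \<and> distinct vs \<and>
     (\<forall>i. Suc i < length vs \<longrightarrow> {vs ! i, vs ! Suc i} \<in> E) \<and> {last vs, hd vs} \<in> E"

definition graph_tree :: "'v set \<Rightarrow> 'v set set \<Rightarrow> bool" where
  "graph_tree V E \<longleftrightarrow>
     simple_graph V E \<and> graph_connected V E \<and> \<not> (\<exists>vs. graph_cycle E vs)"

definition graph_leaf :: "'v set \<Rightarrow> 'v set set \<Rightarrow> 'v \<Rightarrow> bool" where
  "graph_leaf V E t \<longleftrightarrow> t \<in> V \<and> card {f \<in> E. t \<in> f} = 1"

section \<open>Permutation representation graphs\<close>

text \<open>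
  Permutations act on the right in the source, whereas \<open>sym_group\<close> multiplies by
  \<open>(\<circ>)\<close>.  Inversion is an isomorphism between the two conventions that fixes every
  involution, hence every subgroup generated by involutions, so the coset geometries agree.
\<close>

definition involution_in :: "('a, 'b) monoid_scheme \<Rightarrow> 'a \<Rightarrow> bool" where
  "involution_in G x \<longleftrightarrow> x \<in> carrier G \<and> x \<noteq> \<one>\<^bsub>G\<^esub> \<and> x \<otimes>\<^bsub>G\<^esub> x = \<one>\<^bsub>G\<^esub>"

text \<open>
  An edge-labelled graph on \<open>{1..n}\<close> is represented by the function that sends a
  label \<open>i\<close> to the set of \<open>i\<close>-edges.
\<close>

definition perm_rep_graph :: "nat \<Rightarrow> (nat \<Rightarrow> nat \<Rightarrow> nat) \<Rightarrow> nat \<Rightarrow> nat set set" where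
  "perm_rep_graph n \<rho> i = {{a, b} | a b. a \<in> {1..n} \<and> \<rho> i a = b \<and> b \<noteq> a}"

text \<open>
  In the part common to the three types, \<open>e k\<close> is the edge of the tree \<open>(V, E)\<close> with
  label \<open>k\<close>.  As \<open>V\<close> omits exactly three points, \<open>a\<^sub>1\<close>, \<open>a\<^sub>2\<close>, \<open>a\<^sub>3\<close> are distinct.
\<close>

definition tree_part ::
    "nat \<Rightarrow> (nat \<Rightarrow> nat set set) \<Rightarrow> nat \<Rightarrow> nat \<Rightarrow> nat \<Rightarrow> nat \<Rightarrow> bool" where
  "tree_part n \<G> t a\<^sub>1 a\<^sub>2 a\<^sub>3 \<longleftrightarrow>
     (\<exists>V E e. V \<subseteq> {1..n} \<and> card V = n - 3 \<and> graph_tree V E \<and>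
        bij_betw e {2..n - 3} E \<and> (\<forall>k\<in>{2..n - 3}. \<G> k = {e k}) \<and>
        graph_leaf V E t \<and> t \<in> e 2 \<and>
        {1..n} - V = {a\<^sub>1, a\<^sub>2, a\<^sub>3})"

definition type_A :: "nat \<Rightarrow> (nat \<Rightarrow> nat set set) \<Rightarrow> bool" where
  "type_A n \<G> \<longleftrightarrow>
     (\<exists>t a\<^sub>1 a\<^sub>2 a\<^sub>3. tree_part n \<G> t a\<^sub>1 a\<^sub>2 a\<^sub>3 \<and>
        \<G> 0 = {{a\<^sub>2, a\<^sub>3}} \<and> \<G> 1 = {{a\<^sub>1, a\<^sub>2}, {a\<^sub>3, t}})"

definition type_B :: "nat \<Rightarrow> (nat \<Rightarrow> nat set set) \<Rightarrow> bool" where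
  "type_B n \<G> \<longleftrightarrow>
     (\<exists>t a\<^sub>1 a\<^sub>2 a\<^sub>3. tree_part n \<G> t a\<^sub>1 a\<^sub>2 a\<^sub>3 \<and>
        \<G> 0 = {{a\<^sub>2, t}} \<and> \<G> 1 = {{a\<^sub>1, a\<^sub>2}, {t, a\<^sub>3}})"

definition type_C :: "nat \<Rightarrow> (nat \<Rightarrow> nat set set) \<Rightarrow> bool" where
  "type_C n \<G> \<longleftrightarrow>
     (\<exists>t a\<^sub>1 a\<^sub>2 a\<^sub>3. tree_part n \<G> t a\<^sub>1 a\<^sub>2 a\<^sub>3 \<and>
        \<G> 0 = {{a\<^sub>1, a\<^sub>2}, {a\<^sub>3, t}} \<and> \<G> 1 = {{a\<^sub>1, a\<^sub>3}, {a\<^sub>2, t}})"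

text \<open>
  For an involution, prescribing the edges in these definitions amounts to prescribing
  the permutation as the product of the corresponding transpositions.
\<close>

lemma perm_rep_graph_one_edge:
  assumes "involution_in (sym_group n) (\<rho> i)" "x \<in> {1..n}" "y \<in> {1..n}" "x \<noteq> y"
  shows "perm_rep_graph n \<rho> i = {{x, y}} \<longleftrightarrow> \<rho> i = transpose x y"
proof
  have perm: "\<rho> i permutes {1..n}"
    using assms(1) by (simp add: involution_in_def sym_group_carrier)
  assume *: "perm_rep_graph n \<rho> i = {{x, y}}"
  have edge: "{a, \<rho> i a} = {x, y}" if "\<rho> i a \<noteq> a" for a
  proof -
    have "a \<in> {1..n}"
      using perm that by (meson permutes_not_in)
    hence "{a, \<rho> i a} \<in> perm_rep_graph n \<rho> i"
      using that unfolding perm_rep_graph_def by blast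
    thus ?thesis using * by simp
  qed
  have "{x, y} \<in> perm_rep_graph n \<rho> i" using * by simp
  then obtain a where a: "{x, y} = {a, \<rho> i a}" "\<rho> i a \<noteq> a"
    unfolding perm_rep_graph_def by blast
  have inv: "\<rho> i (\<rho> i a) = a" for a
    using assms(1) by (auto simp: involution_in_def sym_group_mult sym_group_one fun_eq_iff)
  have xy: "\<rho> i x = y" "\<rho> i y = x"
    using a inv[of a] by (auto simp: doubleton_eq_iff)
  show "\<rho> i = transpose x y"
  proof
    fix c show "\<rho> i c = transpose x y c"
      using edge[of c] xy by (auto simp: transpose_def doubleton_eq_iff)
  qed
next
  assume *: "\<rho> i = transpose x y"
  show "perm_rep_graph n \<rho> i = {{x, y}}"
    unfolding perm_rep_graph_def * using assms(2-4)
    by (auto simp: transpose_def insert_commute split: if_splits intro!: exI[of _ x])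
qed

lemma perm_rep_graph_two_edges:
  assumes "involution_in (sym_group n) (\<rho> i)"
    and "x \<in> {1..n}" "y \<in> {1..n}" "z \<in> {1..n}" "w \<in> {1..n}" "distinct [x, y, z, w]"
  shows "perm_rep_graph n \<rho> i = {{x, y}, {z, w}} \<longleftrightarrow> \<rho> i = transpose x y \<circ> transpose z w"
proof
  have perm: "\<rho> i permutes {1..n}"
    using assms(1) by (simp add: involution_in_def sym_group_carrier)
  assume *: "perm_rep_graph n \<rho> i = {{x, y}, {z, w}}"
  have edge: "{a, \<rho> i a} = {x, y} \<or> {a, \<rho> i a} = {z, w}" if "\<rho> i a \<noteq> a" for a
  proof -
    have "a \<in> {1..n}"
      using perm that by (meson permutes_not_in)
    hence "{a, \<rho> i a} \<in> perm_rep_graph n \<rho> i"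
      using that unfolding perm_rep_graph_def by blast
    thus ?thesis using * by simp
  qed
  have inv: "\<rho> i (\<rho> i a) = a" for a
    using assms(1) by (auto simp: involution_in_def sym_group_mult sym_group_one fun_eq_iff)
  have swap: "\<rho> i u = v \<and> \<rho> i v = u" if uv: "{u, v} \<in> perm_rep_graph n \<rho> i" for u v
  proof -
    obtain a where "{u, v} = {a, \<rho> i a}"
      using uv unfolding perm_rep_graph_def by blast
    thus ?thesis using inv[of a] by (auto simp: doubleton_eq_iff)
  qed
  have xy: "\<rho> i x = y" "\<rho> i y = x" and zw: "\<rho> i z = w" "\<rho> i w = z"
    using swap[of x y] swap[of z w] * by auto
  show "\<rho> i = transpose x y \<circ> transpose z w"
  proof
    fix c show "\<rho> i c = (transpose x y \<circ> transpose z w) c"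
      using edge[of c] xy zw assms(6) by (auto simp: transpose_def doubleton_eq_iff)
  qed
next
  assume *: "\<rho> i = transpose x y \<circ> transpose z w"
  have "{x, y} \<in> perm_rep_graph n \<rho> i" "{z, w} \<in> perm_rep_graph n \<rho> i"
    unfolding perm_rep_graph_def * using assms(2-6)
    by (auto simp: transpose_def intro: exI[of _ x] exI[of _ z])
  moreover have "perm_rep_graph n \<rho> i \<subseteq> {{x, y}, {z, w}}"
    unfolding perm_rep_graph_def * using assms(6)
    by (auto simp: transpose_def insert_commute split: if_splits)
  ultimately show "perm_rep_graph n \<rho> i = {{x, y}, {z, w}}" by blast
qed

end

(*
  If pairwise intersecting cosets of the \<Gamma> i always have a common point, every flag is a translate
  of a standard one, and flag-transitivity follows.  For i \<ge> 3 the group \<Gamma> i is the full setwise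
  stabilizer of the part Y i of the tree that the i-edge cuts off from t, so a coset of \<Gamma> i amounts
  to the preimage of Y i.  The sets Y i form a laminar family, and compatible preimages are realized
  by one permutation, built up by increasing size.  For i \<le> 2 the group \<Gamma> i preserves a subset W i of
  {a1, a2, a3, t}, which every Y j with j \<ge> 3 avoids, and contains all permutations fixing W i
  pointwise; so only the triple {0, 1, 2} needs an argument, namely the factorization
  \<Gamma> 2 \<inter> \<Gamma> 1 \<Gamma> 0 = (\<Gamma> 1 \<inter> \<Gamma> 2)(\<Gamma> 0 \<inter> \<Gamma> 2), which is checked on the four points a1, a2, a3, t.
*)

theory Submission
  imports Defs
begin

section \<open>Coset geometries with the Helly property\<close>

text \<open>Label 2 is exceptional because its edge is the only tree edge at \<open>t\<close>, and
  this edge is what splits a double transposition \<open>(x y)(z t)\<close> into its two factors.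
  For i \<noteq> 2 the group \<open>\<Gamma> i\<close> contains it and hence every permutation
  supported on its orbit of \<open>t\<close>; for i \<le> 1 the set \<open>W i\<close> is the
  complement of that orbit. \<open>\<Gamma> 2\<close> lacks the edge and acts on the four points
  only through \<open>\<rho> 0\<close> and \<open>\<rho> 1\<close>: as a dihedral group of order 8
  in types A and B, as a Klein four-group in type C. This is where laminarity stops.
  \<open>W 0\<close> and \<open>W 1\<close> cross in types B and C, in type A
  \<open>\<Gamma> 1\<close> is not the full stabilizer of \<open>W 1\<close>, and
  \<open>\<Gamma> 2\<close> is not that of \<open>W 2\<close>. The products of a power of
  \<open>\<rho> 0\<close> with a power of \<open>\<rho> 1\<close> are four permutations: the whole
  Klein group, but only half of the dihedral one. In types A and B the correct half is singled out
  by \<open>\<Gamma> 1\<close> fixing \<open>a\<^sub>1\<close> and \<open>\<Gamma> 0\<close>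
  preserving \<open>{a\<^sub>1, a\<^sub>2}\<close>.\<close>

definition coset_helly ::
    "('a, 'b) monoid_scheme \<Rightarrow> ('i \<Rightarrow> 'a set) \<Rightarrow> 'i set \<Rightarrow> bool" where
  "coset_helly G H I \<longleftrightarrow>
     (\<forall>J\<subseteq>I. \<forall>g\<in>J \<rightarrow> carrier G.
        (\<forall>i\<in>J. \<forall>j\<in>J. (H i #>\<^bsub>G\<^esub> g i) \<inter> (H j #>\<^bsub>G\<^esub> g j) \<noteq> {})
        \<longrightarrow> (\<exists>x\<in>carrier G. \<forall>i\<in>J. x \<in> H i #>\<^bsub>G\<^esub> g i))"

lemma coset_hellyD:
  assumes "coset_helly G H I" "J \<subseteq> I" "\<And>i. i \<in> J \<Longrightarrow> g i \<in> carrier G"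
    and "\<And>i j. i \<in> J \<Longrightarrow> j \<in> J \<Longrightarrow> (H i #>\<^bsub>G\<^esub> g i) \<inter> (H j #>\<^bsub>G\<^esub> g j) \<noteq> {}"
  obtains x where "x \<in> carrier G" "\<And>i. i \<in> J \<Longrightarrow> x \<in> H i #>\<^bsub>G\<^esub> g i"
proof -
  have "g \<in> J \<rightarrow> carrier G" using assms(3) by blast
  thus thesis using assms(1,2,4) that unfolding coset_helly_def by meson
qed

lemma (in group) inv_mult_cancel:
  assumes "x \<in> carrier G" "y \<in> carrier G"
  shows "inv x \<otimes> (x \<otimes> y) = y"
  using assms by (simp add: m_assoc[symmetric])

lemma (in group) coset_same:
  assumes "subgroup K G" "g \<in> carrier G" "x \<in> K #> g"
  shows "x \<in> carrier G" "K #> x = K #> g"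
  using assms repr_independence[of x K g] subgroup.rcosets_carrier[OF assms(1) is_group]
    r_coset_subset_G[OF subgroup.subset[OF assms(1)] assms(2)] by auto

lemma (in group) coset_diff:
  assumes "subgroup K G" "g \<in> carrier G" "x \<in> K #> g" "y \<in> K #> g"
  shows "x \<otimes> inv y \<in> K"
  using coset_same[OF assms(1,2,4)] assms(3) subgroup.rcos_module[OF assms(1) is_group]
    coset_same[OF assms(1,2,3)] by auto

lemma (in group) coset_mult_closed:
  assumes "subgroup K G" "g \<in> carrier G" "x \<in> K #> g" "k \<in> K"
  shows "k \<otimes> x \<in> K #> g"
  using assms coset_same[OF assms(1-3)] unfolding r_coset_def by auto

text \<open>Distinct cosets of one subgroup are disjoint, so a flag has a single element of each of
  its types; a point common to all of them represents every coset at once.\<close>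

lemma (in group) flag_eq_translate:
  assumes sub: "\<And>i. i \<in> I \<Longrightarrow> subgroup (H i) G" and helly: "coset_helly G H I"
    and F: "coset_flag G H I F"
  obtains x where "x \<in> carrier G" "F = (\<lambda>i. (i, H i #> x)) ` flag_type F"
proof -
  let ?J = "flag_type F"
  have el: "\<exists>g\<in>carrier G. C = H i #> g \<and> i \<in> I" if "(i, C) \<in> F" for i C
    using F that unfolding coset_flag_def coset_elements_def by blast
  have meet: "C \<inter> D \<noteq> {}" if "(i, C) \<in> F" "(j, D) \<in> F" for i j C D
    using F that unfolding coset_flag_def coset_incident_def by fastforce
  have "\<forall>i\<in>?J. \<exists>g. g \<in> carrier G \<and> (i, H i #> g) \<in> F"
    using el unfolding flag_type_def by force
  then obtain g where g: "\<And>i. i \<in> ?J \<Longrightarrow> g i \<in> carrier G \<and> (i, H i #> g i) \<in> F"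
    by metis
  have JI: "?J \<subseteq> I" using g el by blast
  obtain x where x: "x \<in> carrier G" "\<And>i. i \<in> ?J \<Longrightarrow> x \<in> H i #> g i"
  proof (rule coset_hellyD[OF helly JI])
    show "(H i #> g i) \<inter> (H j #> g j) \<noteq> {}" if "i \<in> ?J" "j \<in> ?J" for i j
      using meet g[OF that(1)] g[OF that(2)] by blast
  qed (use g in auto)
  have eq: "C = H i #> x" if iC: "(i, C) \<in> F" for i C
  proof -
    have i: "i \<in> ?J" using iC unfolding flag_type_def by force
    obtain h where h: "h \<in> carrier G" "C = H i #> h" "i \<in> I" using el[OF iC] by blast
    have "C \<inter> (H i #> g i) \<noteq> {}"
      using meet[OF iC] g[OF i] by blast
    then obtain y where y: "y \<in> C" "y \<in> H i #> g i" by blast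
    have "C = H i #> y" using coset_same[OF sub h(1)] h y by auto
    also have "\<dots> = H i #> x"
      using coset_same[OF sub _ y(2)] coset_same[OF sub _ x(2)[OF i]] g[OF i] h(3) by auto
    finally show ?thesis .
  qed
  have "F = (\<lambda>i. (i, H i #> x)) ` ?J"
  proof
    show "F \<subseteq> (\<lambda>i. (i, H i #> x)) ` ?J"
      using eq unfolding flag_type_def by force
    show "(\<lambda>i. (i, H i #> x)) ` ?J \<subseteq> F"
      using g eq by fastforce
  qed
  thus thesis using x(1) that by blast
qed

lemma (in group) coset_helly_imp_flag_transitive:
  assumes sub: "\<And>i. i \<in> I \<Longrightarrow> subgroup (H i) G" and helly: "coset_helly G H I"
  shows "flag_transitive G H I"
  unfolding flag_transitive_def
proof (intro allI impI, elim conjE)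
  fix J F F'
  assume J: "J \<subseteq> I" and F: "coset_flag G H I F" "flag_type F = J"
    and F': "coset_flag G H I F'" "flag_type F' = J"
  obtain x where x: "x \<in> carrier G" "F = (\<lambda>i. (i, H i #> x)) ` J"
    using flag_eq_translate[OF sub helly F(1)] F(2) by auto
  obtain y where y: "y \<in> carrier G" "F' = (\<lambda>i. (i, H i #> y)) ` J"
    using flag_eq_translate[OF sub helly F'(1)] F'(2) by auto
  have "H i #> x #> (inv x \<otimes> y) = H i #> y" if "i \<in> J" for i
  proof -
    have "H i \<subseteq> carrier G" using sub that J subgroup.subset by blast
    thus ?thesis using x(1) y(1) by (simp add: coset_mult_assoc m_assoc[symmetric])
  qed
  hence "flag_act G F (inv x \<otimes> y) = F'"
    unfolding flag_act_def x(2) y(2) by (auto simp: image_image)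
  thus "\<exists>g\<in>carrier G. flag_act G F g = F'" using x(1) y(1) by blast
qed

text \<open>Points chosen in the three pairwise intersections have quotients in \<open>H 1\<close>,
  \<open>H 0\<close> and \<open>H 2\<close>, and the first two multiply to the third. The
  obstruction to a common point is thus an element of \<open>H 2\<close> lying in the product of
  \<open>H 1\<close> and \<open>H 0\<close>; it vanishes once both factors can be taken in
  \<open>H 2\<close>.\<close>

lemma (in group) coset_helly_three:
  assumes sub: "subgroup (H (0::nat)) G" "subgroup (H 1) G" "subgroup (H 2) G"
    and fact: "\<And>a b. a \<in> H 0 \<Longrightarrow> b \<in> H 1 \<Longrightarrow> b \<otimes> a \<in> H 2 \<Longrightarrow>
                 \<exists>b'\<in>H 1 \<inter> H 2. \<exists>a'\<in>H 0 \<inter> H 2. b \<otimes> a = b' \<otimes> a'"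
  shows "coset_helly G H {0, 1, 2}"
  unfolding coset_helly_def
proof (intro allI impI ballI)
  fix J g assume J: "J \<subseteq> {0::nat, 1, 2}" and g: "g \<in> J \<rightarrow> carrier G"
    and meet: "\<forall>i\<in>J. \<forall>j\<in>J. (H i #> g i) \<inter> (H j #> g j) \<noteq> {}"
  have sub': "subgroup (H i) G" if "i \<in> J" for i using that J sub by auto
  have gc: "g i \<in> carrier G" if "i \<in> J" for i using g that by auto
  show "\<exists>x\<in>carrier G. \<forall>i\<in>J. x \<in> H i #> g i"
  proof (cases "J = {0, 1, 2}")
    case False
    have pair: ?thesis if ij: "J \<subseteq> {i, j}" for i j
    proof (cases "J = {}")
      case False
      then obtain i' j' where ij': "i' \<in> J" "j' \<in> J" "J \<subseteq> {i', j'}" using ij by blast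
      then obtain x where "x \<in> H i' #> g i'" "x \<in> H j' #> g j'" using meet by blast
      thus ?thesis using ij' coset_same(1)[OF sub' gc] by blast
    qed auto
    obtain k where "k \<in> {0, 1, 2}" "k \<notin> J" using J False by blast
    hence "J \<subseteq> {1, 2} \<or> J \<subseteq> {0, 2} \<or> J \<subseteq> {0, 1}" using J by blast
    thus ?thesis using pair by blast
  next
    case True
    obtain x where x: "x \<in> H 1 #> g 1" "x \<in> H 0 #> g 0" using meet True by blast
    obtain y where y: "y \<in> H 0 #> g 0" "y \<in> H 2 #> g 2" using meet True by blast
    obtain z where z: "z \<in> H 1 #> g 1" "z \<in> H 2 #> g 2" using meet True by blast
    have g': "g 0 \<in> carrier G" "g 1 \<in> carrier G" "g 2 \<in> carrier G" using gc True by auto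
    have c: "x \<in> carrier G" "y \<in> carrier G" "z \<in> carrier G"
      using coset_same(1)[OF sub(2) g'(2) x(1)] coset_same(1)[OF sub(1) g'(1) y(1)]
        coset_same(1)[OF sub(2) g'(2) z(1)] by auto
    have "z \<otimes> inv x \<in> H 1" "x \<otimes> inv y \<in> H 0" "z \<otimes> inv y \<in> H 2"
      using coset_diff sub g' x y z by blast+
    moreover have e: "(z \<otimes> inv x) \<otimes> (x \<otimes> inv y) = z \<otimes> inv y"
      using c by (simp add: m_assoc inv_mult_cancel)
    ultimately obtain b a where ba: "b \<in> H 1 \<inter> H 2" "a \<in> H 0 \<inter> H 2" "z \<otimes> inv y = b \<otimes> a"
      using fact by metis
    have bc: "b \<in> carrier G" "a \<in> carrier G" using ba subgroup.subset[OF sub(3)] by auto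
    have ib: "inv b \<in> H 1" "inv b \<in> H 2"
      using ba subgroup.m_inv_closed[OF sub(2)] subgroup.m_inv_closed[OF sub(3)] by auto
    \<comment> \<open>This is the common point: the left form stays in the cosets of types 1 and 2,
      the right form in the coset of type 0.\<close>
    have eq: "inv b \<otimes> z = a \<otimes> y"
    proof -
      have "z = b \<otimes> a \<otimes> y" using ba(3) c bc inv_solve_right[of "b \<otimes> a" z y] by simp
      thus ?thesis using c bc by (simp add: m_assoc inv_mult_cancel)
    qed
    have "inv b \<otimes> z \<in> H 1 #> g 1" "inv b \<otimes> z \<in> H 2 #> g 2" "a \<otimes> y \<in> H 0 #> g 0"
      using coset_mult_closed[OF sub(2) g'(2) z(1) ib(1)] coset_mult_closed[OF sub(3) g'(3) z(2) ib(2)]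
        coset_mult_closed[OF sub(1) g'(1) y(1)] ba(2) by auto
    thus ?thesis using eq True c bc by (intro bexI[of _ "inv b \<otimes> z"]) auto
  qed
qed

section \<open>Permutations prescribed on part of their domain\<close>

lemma permutes_extending:
  assumes "finite S" "inj_on f A" "A \<subseteq> S" "f ` A \<subseteq> S"
  obtains h where "h permutes S" "\<And>x. x \<in> A \<Longrightarrow> h x = f x"
proof -
  have "card (S - A) = card (S - f ` A)"
    using assms by (simp add: card_Diff_subset finite_subset card_image)
  then obtain k where k: "bij_betw k (S - A) (S - f ` A)"
    using assms(1) finite_same_card_bij[of "S - A" "S - f ` A"] by auto
  define h where "h x = (if x \<in> A then f x else if x \<in> S then k x else x)" for x
  have "bij_betw h A (f ` A)"
    using assms(2) by (auto simp: bij_betw_def h_def cong: inj_on_cong)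
  moreover have "bij_betw h (S - A) (S - f ` A)"
    using k by (rule bij_betw_cong[THEN iffD1, rotated]) (auto simp: h_def)
  ultimately have "bij_betw h (A \<union> (S - A)) (f ` A \<union> (S - f ` A))"
    by (rule bij_betw_combine) auto
  hence "bij_betw h S S"
    using assms(3,4) by (simp add: Un_absorb1)
  hence "h permutes S"
    by (rule bij_imp_permutes) (use assms(3) in \<open>auto simp: h_def\<close>)
  thus thesis using that by (auto simp: h_def)
qed

lemma permutes_onto_subset:
  assumes "finite S" "A \<subseteq> S" "B \<subseteq> S" "card A = card B"
  obtains h where "h permutes S" "h ` A = B"
proof -
  obtain f where f: "bij_betw f A B"
    using assms finite_same_card_bij[of A B] finite_subset by metis
  hence "inj_on f A" "f ` A = B" by (auto simp: bij_betw_def)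
  moreover from this obtain h where "h permutes S" "\<And>x. x \<in> A \<Longrightarrow> h x = f x"
    using permutes_extending[OF assms(1) _ assms(2)] assms(3) by blast
  ultimately have "h permutes S" "h ` A = B" by auto
  thus thesis by (rule that)
qed

text \<open>Pairwise realizability gives the \<open>B i\<close> the sizes and mutual position of the
  \<open>Y i\<close>. A set of largest size contains or avoids each of the others, so a permutation
  that already treats the others correctly can be repaired for it without moving any of their
  points.\<close>

lemma laminar_simultaneous_image:
  fixes Y B :: "'i \<Rightarrow> 'a set"
  assumes "finite S" "finite J" and Y: "\<And>i. i \<in> J \<Longrightarrow> Y i \<subseteq> S"
    and lam: "\<And>i j. i \<in> J \<Longrightarrow> j \<in> J \<Longrightarrow> Y i \<subseteq> Y j \<or> Y j \<subseteq> Y i \<or> Y i \<inter> Y j = {}"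
    and pair: "\<And>i j. i \<in> J \<Longrightarrow> j \<in> J \<Longrightarrow> \<exists>p. p permutes S \<and> p ` B i = Y i \<and> p ` B j = Y j"
  shows "\<exists>x. x permutes S \<and> (\<forall>i\<in>J. x ` B i = Y i)"
  using assms(2-)
proof (induction J rule: finite_ranking_induct[where f = "\<lambda>i. card (Y i)"])
  case empty
  show ?case by (rule exI[of _ id]) (simp add: permutes_id del: id_apply)
next
  case (insert k J)
  obtain x where x: "x permutes S" "\<And>i. i \<in> J \<Longrightarrow> x ` B i = Y i"
    using insert.IH insert.prems by (metis insertCI)
  define Z C where "Z = (\<Union>i\<in>J. Y i)" and "C = x ` B k"
  have Yk: "Y k \<subseteq> S" using insert.prems(1) by blast
  \<comment> \<open>The diagonal case of the pairwise hypothesis yields both facts.\<close>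
  have Bk: "B k \<subseteq> S \<and> card (B k) = card (Y k)"
  proof -
    obtain p where p: "p permutes S" "p ` B k = Y k" using insert.prems(3)[of k k] by auto
    have "B k \<subseteq> S"
      using Yk p(1) unfolding p(2)[symmetric] by (auto simp: permutes_in_image)
    moreover have "card (p ` B k) = card (B k)"
      by (rule card_image) (rule inj_on_subset[OF permutes_inj[OF p(1)]], simp)
    ultimately show ?thesis by (simp add: p(2))
  qed
  have C: "C \<subseteq> S" "card C = card (Y k)"
    using Bk x(1) permutes_inj[OF x(1)] unfolding C_def
    by (auto simp: permutes_in_image card_image inj_on_subset)
  have CY: "C \<inter> Y i = Y k \<inter> Y i" if i: "i \<in> J" for i
  proof -
    obtain p where p: "p permutes S" "p ` B i = Y i" "p ` B k = Y k"
      using insert.prems(3)[of i k] i by auto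
    have ip: "inj p" and ix: "inj x" using p(1) x(1) permutes_inj by blast+
    have "Y i \<subseteq> Y k \<or> Y i \<inter> Y k = {}"
    proof -
      have "finite (Y i)" using insert.prems(1)[of i] i assms(1) finite_subset by blast
      \<comment> \<open>The ranking allows ties, so an earlier set can contain \<open>Y k\<close>
        only by being equal to it.\<close>
      hence "Y k \<subseteq> Y i \<Longrightarrow> Y k = Y i" using insert.hyps(2)[OF i] by (metis card_seteq)
      thus ?thesis using insert.prems(2)[of i k] i by blast
    qed
    thus ?thesis
    proof
      assume s: "Y i \<subseteq> Y k"
      hence "B i \<subseteq> B k" using p ip by (metis inj_image_subset_iff)
      thus ?thesis using s x(2)[OF i] unfolding C_def by blast
    next
      assume d: "Y i \<inter> Y k = {}"
      hence "B i \<inter> B k = {}" using p by blast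
      hence "x ` B i \<inter> x ` B k = {}" using ix by (metis image_Int image_empty)
      thus ?thesis using d x(2)[OF i] unfolding C_def by blast
    qed
  qed
  hence CZ: "C \<inter> Z = Y k \<inter> Z" unfolding Z_def by blast
  have fin: "finite C" "finite (Y k)" using C(1) Yk assms(1) finite_subset by auto
  \<comment> \<open>\<open>C\<close> and \<open>Y k\<close> agree on \<open>Z\<close> and have equal
    size, so they differ only outside \<open>Z\<close>. A permutation supported there corrects the
    image of \<open>B k\<close> and fixes the images already obtained.\<close>
  have "card (C - Z) = card (Y k - Z)"
    using fin CZ C(2) by (metis card_Diff_subset_Int finite_Int)
  then obtain h where h: "h permutes (S - Z)" "h ` (C - Z) = Y k - Z"
    using permutes_onto_subset[of "S - Z" "C - Z" "Y k - Z"] assms(1) C(1) Yk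
    by (metis Diff_mono finite_Diff order_refl)
  have hZ: "h ` D = D" if "D \<subseteq> Z" for D
    using that permutes_not_in[OF h(1)] by (force simp: image_iff)
  have "h ` C = h ` (C - Z) \<union> h ` (C \<inter> Z)" by blast
  also have "\<dots> = Y k" using h(2) hZ[of "C \<inter> Z"] CZ by auto
  finally have "(h \<circ> x) ` B k = Y k" by (simp add: C_def image_comp)
  moreover have "(h \<circ> x) ` B i = Y i" if "i \<in> J" for i
  proof -
    have "(h \<circ> x) ` B i = h ` Y i" using x(2)[OF that] by (metis image_comp)
    also have "\<dots> = Y i" using that by (intro hZ) (auto simp: Z_def)
    finally show ?thesis .
  qed
  moreover have "h \<circ> x permutes S"
    using x(1) permutes_subset[OF h(1)] by (intro permutes_compose) auto
  ultimately show ?case by (intro exI[of _ "h \<circ> x"]) blast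
qed

section \<open>Subgroups of the symmetric group\<close>

lemma subgroup_permutes:
  assumes "subgroup M (sym_group n)" "p \<in> M"
  shows "p permutes {1..n}"
  using subgroup.subset[OF assms(1)] assms(2) by (auto simp: sym_group_carrier)

lemma subgroup_comp:
  assumes "subgroup M (sym_group n)" "p \<in> M" "q \<in> M"
  shows "p \<circ> q \<in> M"
  using subgroup.m_closed[OF assms] by (simp add: sym_group_mult)

lemma subgroup_id:
  assumes "subgroup M (sym_group n)"
  shows "id \<in> M"
  using subgroup.one_closed[OF assms] by (simp add: sym_group_one)

lemma mem_coset_iff:
  assumes "subgroup M (sym_group n)" "x permutes {1..n}" "g permutes {1..n}"
  shows "x \<in> M #>\<^bsub>sym_group n\<^esub> g \<longleftrightarrow> x \<circ> inv' g \<in> M"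
  using subgroup.rcos_module[OF assms(1) sym_group_is_group, of g x] assms
  by (simp add: sym_group_carrier sym_group_mult)

lemma subgroup_if_transposes:
  assumes "subgroup M (sym_group n)" "\<And>x y. x \<in> C \<Longrightarrow> y \<in> C \<Longrightarrow> transpose x y \<in> M"
    and "finite C" "p permutes C"
  shows "p \<in> M"
  using assms(4,3)
proof (induction rule: permutes_induct)
  case id
  show ?case by (rule subgroup_id[OF assms(1)])
next
  case (swap a b p)
  thus ?case using assms(2) by (intro subgroup_comp[OF assms(1)])
qed

lemma subgroup_transpose_trans:
  assumes "subgroup M (sym_group n)" "transpose x y \<in> M" "transpose y z \<in> M"
  shows "transpose x z \<in> M"
proof (cases "x = y \<or> y = z \<or> x = z")
  case True
  thus ?thesis using assms subgroup_id by auto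
next
  case False
  hence "transpose x z = transpose x y \<circ> transpose y z \<circ> transpose x y"
    by (auto simp: fun_eq_iff transpose_def)
  thus ?thesis using assms by (simp add: subgroup_comp)
qed

lemma subgroup_if_star:
  assumes M: "subgroup M (sym_group n)" and star: "\<And>x. x \<in> C \<Longrightarrow> transpose x c \<in> M"
    and "finite C" "p permutes C"
  shows "p \<in> M"
  using M _ assms(3,4)
proof (rule subgroup_if_transposes)
  show "transpose x y \<in> M" if "x \<in> C" "y \<in> C" for x y
    using subgroup_transpose_trans[OF M star[OF that(1)], of y] star[OF that(2)]
    by (simp add: transpose_commute[of c y])
qed

text \<open>With \<open>r = (x y)(z t)\<close> and \<open>q = (t s)\<close>, the cube of \<open>r q\<close> is \<open>(x y)\<close>.\<close>

lemma subgroup_split_double_transpose: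
  assumes M: "subgroup M (sym_group n)" and "distinct [x, y, z, t, s]"
    and r: "transpose x y \<circ> transpose z t \<in> M" and q: "transpose t s \<in> M"
  shows "transpose x y \<in> M" "transpose z t \<in> M"
proof -
  \<comment> \<open>Conjugation takes the place of the cube: \<open>r q r\<close> is
    \<open>(z s)\<close>, which together with \<open>(t s)\<close> gives \<open>(z t)\<close>;
    cancelling it from \<open>r\<close> leaves \<open>(x y)\<close>.\<close>
  have "(transpose x y \<circ> transpose z t) \<circ> transpose t s \<circ>
      (transpose x y \<circ> transpose z t) = transpose z s"
    using assms(2) by (auto simp: fun_eq_iff transpose_def)
  hence "transpose z s \<in> M" using M r q subgroup_comp by metis
  thus zt: "transpose z t \<in> M"
    using subgroup_transpose_trans[OF M] q by (metis transpose_commute)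
  have "transpose x y \<circ> transpose z t \<circ> transpose z t = transpose x y"
    by (simp add: comp_assoc)
  thus "transpose x y \<in> M" using subgroup_comp[OF M r zt] by simp
qed

text \<open>\<open>Q\<close> is a family of sets that may be permuted among themselves. A singleton
  family expresses setwise invariance of one set, a family of two disjoint pairs the invariance of a
  pairing.\<close>

lemma generate_preserves:
  assumes "\<And>x. x \<in> X \<Longrightarrow> x permutes {1..n} \<and> (`) x ` Q = Q"
    and "p \<in> generate (sym_group n) X"
  shows "(`) p ` Q = Q"
  using assms(2)
proof induction
  case one
  show ?case by (simp add: sym_group_one)
next
  case (incl h)
  thus ?case using assms(1) by blast
next
  case (inv h)
  have h: "h permutes {1..n}" "(`) h ` Q = Q" using assms(1) inv by blast+
  have "(`) (inv' h) ` (`) h ` Q = Q"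
    by (simp add: image_image permutes_inv_o(2)[OF h(1)] image_comp del: image_image)
  thus ?case using h by (simp add: sym_group_carrier)
next
  case (eng h1 h2)
  have "(`) (h1 \<circ> h2) ` Q = (`) h1 ` (`) h2 ` Q" by (simp add: image_comp image_image)
  thus ?case using eng by (simp add: sym_group_mult)
qed

lemma stabilizer_subset_if_parts:
  assumes M: "subgroup M (sym_group n)" and "Y \<subseteq> {1..n}"
    and "\<And>p. p permutes Y \<Longrightarrow> p \<in> M" "\<And>p. p permutes {1..n} - Y \<Longrightarrow> p \<in> M"
    and p: "p permutes {1..n}" "p ` Y = Y"
  shows "p \<in> M"
proof -
  define q r where "q x = (if x \<in> Y then p x else x)" and "r x = (if x \<in> Y then x else p x)" for x
  have bij: "bij_betw p {1..n} {1..n}" using p(1) permutes_imp_bij by blast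
  have "bij_betw p ({1..n} - Y) ({1..n} - Y)"
    using bij_betw_subset[OF bij, of "{1..n} - Y"] p(2) bij assms(2)
    by (metis Diff_subset bij_betw_def inj_on_image_set_diff order_refl)
  hence "bij_betw r ({1..n} - Y) ({1..n} - Y)"
    by (rule bij_betw_cong[THEN iffD1, rotated]) (auto simp: r_def)
  hence r: "r permutes {1..n} - Y"
    by (rule bij_imp_permutes) (use permutes_not_in[OF p(1)] in \<open>auto simp: r_def\<close>)
  have "bij_betw p Y Y" using p permutes_inj_on[OF p(1)] by (auto simp: bij_betw_def)
  hence "bij_betw q Y Y"
    by (rule bij_betw_cong[THEN iffD1, rotated]) (auto simp: q_def)
  hence q: "q permutes Y" by (rule bij_imp_permutes) (auto simp: q_def)
  have "p x = (q \<circ> r) x" for x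
  proof (cases "x \<in> Y")
    case False
    hence "r x \<notin> Y" using permutes_in_image[OF r, of x] permutes_not_in[OF r, of x]
      by (cases "x \<in> {1..n} - Y") auto
    thus ?thesis using False by (simp add: q_def r_def)
  qed (simp add: q_def r_def)
  hence "p = q \<circ> r" by blast
  thus ?thesis using assms(3)[OF q] assms(4)[OF r] subgroup_comp[OF M] by blast
qed

text \<open>One permutation solves the conditions from \<open>L\<close>, another those from
  \<open>K\<close>. The second is corrected by a permutation supported off all relevant
  \<open>W k\<close>: such a correction belongs to every \<open>H k\<close> in question, and since
  the \<open>Y j\<close> avoid the \<open>W k\<close> there is enough room for it.\<close>

lemma coset_helly_combine:
  fixes H :: "'i \<Rightarrow> (nat \<Rightarrow> nat) set" and Y W :: "'i \<Rightarrow> nat set"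
  assumes "finite L" and sub: "\<And>i. i \<in> L \<union> K \<Longrightarrow> subgroup (H i) (sym_group n)"
    and Y: "\<And>j. j \<in> L \<Longrightarrow> Y j \<subseteq> {1..n}"
    and stab: "\<And>j. j \<in> L \<Longrightarrow> H j = {p. p permutes {1..n} \<and> p ` Y j = Y j}"
    and lam: "\<And>i j. i \<in> L \<Longrightarrow> j \<in> L \<Longrightarrow> Y i \<subseteq> Y j \<or> Y j \<subseteq> Y i \<or> Y i \<inter> Y j = {}"
    and W: "\<And>k p. k \<in> K \<Longrightarrow> p \<in> H k \<Longrightarrow> p ` W k = W k"
    and young: "\<And>k p. k \<in> K \<Longrightarrow> p permutes {1..n} - W k \<Longrightarrow> p \<in> H k"
    and disj: "\<And>j k. j \<in> L \<Longrightarrow> k \<in> K \<Longrightarrow> Y j \<inter> W k = {}"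
    and helly: "coset_helly (sym_group n) H K"
  shows "coset_helly (sym_group n) H (L \<union> K)"
  unfolding coset_helly_def
proof (intro allI impI ballI)
  interpret group "sym_group n" by (rule sym_group_is_group)
  fix J g assume J: "J \<subseteq> L \<union> K" and g: "g \<in> J \<rightarrow> carrier (sym_group n)"
    and meet: "\<forall>i\<in>J. \<forall>j\<in>J. (H i #>\<^bsub>sym_group n\<^esub> g i) \<inter> (H j #>\<^bsub>sym_group n\<^esub> g j) \<noteq> {}"
  define C where "C i = H i #>\<^bsub>sym_group n\<^esub> g i" for i
  have common: "\<exists>x. x \<in> C i \<and> x \<in> C j" if "i \<in> J" "j \<in> J" for i j
    using meet[rule_format, OF that] unfolding C_def by blast
  define B where "B j = inv' (g j) ` Y j" for j
  have subJ: "subgroup (H i) (sym_group n)" if "i \<in> J" for i using that J sub by blast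
  have gc: "g i \<in> carrier (sym_group n)" if "i \<in> J" for i using g that by blast
  hence gp: "g i permutes {1..n}" if "i \<in> J" for i using that by (simp add: sym_group_carrier)
  have Cp: "x permutes {1..n}" if "x \<in> C i" "i \<in> J" for x i
    using coset_same(1)[OF subJ gc] that by (simp add: C_def sym_group_carrier)
  have CL: "x \<in> C j \<longleftrightarrow> x ` B j = Y j" if "j \<in> J" "j \<in> L" "x permutes {1..n}" for x j
  proof -
    have "x \<circ> inv' (g j) permutes {1..n}"
      using permutes_compose[OF permutes_inv[OF gp]] that by blast
    moreover have "x \<in> C j \<longleftrightarrow> x \<circ> inv' (g j) \<in> H j"
      using mem_coset_iff[OF subJ _ gp] that unfolding C_def by blast
    ultimately show ?thesis
      unfolding stab[OF that(2)] B_def image_comp by blast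
  qed
  have BS: "B j \<subseteq> {1..n}" if "j \<in> J" "j \<in> L" for j
    using permutes_image[OF permutes_inv[OF gp]] Y[of j] that unfolding B_def by blast
  have "\<exists>x. x permutes {1..n} \<and> (\<forall>j\<in>J \<inter> L. x ` B j = Y j)"
  proof (rule laminar_simultaneous_image)
    show "finite (J \<inter> L)" using assms(1) by simp
    show "\<exists>p. p permutes {1..n} \<and> p ` B i = Y i \<and> p ` B j = Y j"
      if ij: "i \<in> J \<inter> L" "j \<in> J \<inter> L" for i j
    proof -
      obtain p where p: "p \<in> C i" "p \<in> C j" using common[of i j] ij by blast
      have "p permutes {1..n}" using Cp[OF p(1)] ij by blast
      thus ?thesis using CL[of i p] CL[of j p] p ij by blast
    qed
  qed (use Y lam in auto)
  then obtain x1 where x1: "x1 permutes {1..n}" "\<And>j. j \<in> J \<Longrightarrow> j \<in> L \<Longrightarrow> x1 ` B j = Y j" by blast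
  obtain x2 where x2: "x2 \<in> carrier (sym_group n)" "\<And>k. k \<in> J \<inter> K \<Longrightarrow> x2 \<in> C k"
    using coset_hellyD[OF helly, of "J \<inter> K" g] gc meet unfolding C_def by auto
  have x2p: "x2 permutes {1..n}" using x2(1) by (simp add: sym_group_carrier)
  \<comment> \<open>Here the mixed incidences enter: a common point \<open>y\<close> of the cosets
    \<open>j\<close> and \<open>k\<close> sends \<open>B j\<close> to \<open>Y j\<close>, away from
    \<open>W k\<close>, and \<open>x2\<close> differs from \<open>y\<close> by an element of
    \<open>H k\<close>, which preserves \<open>W k\<close>.\<close>
  have avoid: "x2 ` B j \<inter> W k = {}" if j: "j \<in> J" "j \<in> L" and k: "k \<in> J" "k \<in> K" for j k
  proof -
    obtain y where y: "y \<in> C j" "y \<in> C k" using common[of j k] j k by blast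
    have yp: "y permutes {1..n}" using Cp[OF y(1)] j by blast
    define h where "h = x2 \<circ> inv' y"
    have "h \<in> H k"
      using coset_diff[OF subJ[OF k(1)] gc[OF k(1)], of x2 y] k y(2) x2(2) yp
      by (simp add: h_def C_def sym_group_mult sym_group_carrier)
    hence hW: "h ` W k = W k" and "inj h"
      using W[OF k(2)] permutes_inj[OF subgroup_permutes[OF subJ[OF k(1)]]] by auto
    have "x2 = h \<circ> y"
      using permutes_inv_o(2)[OF yp] by (simp add: h_def comp_assoc)
    hence "x2 ` B j = h ` Y j"
      using CL[OF j yp] y(1) by (metis image_comp)
    moreover have "h ` Y j \<inter> h ` W k = {}"
      using disj[OF j(2) k(2)] \<open>inj h\<close> by (metis image_Int image_empty)
    ultimately show ?thesis using hW by simp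
  qed
  define U where "U = (\<Union>j\<in>J \<inter> L. B j)"
  define S where "S = {1..n} - (\<Union>k\<in>J \<inter> K. W k)"
  define f where "f = x1 \<circ> inv' x2"
  have fx2: "f ` x2 ` D = x1 ` D" for D
    unfolding f_def by (simp add: image_comp comp_assoc permutes_inv_o(2)[OF x2p] del: comp_apply)
  have "x2 ` U \<subseteq> S"
    using BS avoid permutes_in_image[OF x2p] unfolding U_def S_def by blast
  moreover have "f ` x2 ` U \<subseteq> S"
    unfolding fx2 using x1(2) Y disj unfolding U_def S_def by blast
  moreover have "inj_on f (x2 ` U)"
    using permutes_inj[OF permutes_compose[OF permutes_inv[OF x2p] x1(1)]]
    unfolding f_def by (metis inj_on_subset subset_UNIV)
  moreover have "finite S" by (simp add: S_def)
  ultimately obtain h where h: "h permutes S" "\<And>z. z \<in> x2 ` U \<Longrightarrow> h z = f z"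
    using permutes_extending[of S f "x2 ` U"] by metis
  have "h permutes {1..n}" using permutes_subset[OF h(1)] by (auto simp: S_def)
  hence xp: "h \<circ> x2 permutes {1..n}" using permutes_compose[OF x2p] by blast
  have "h \<circ> x2 \<in> C i" if i: "i \<in> J" for i
  proof (cases "i \<in> K")
    case True
    have "h \<in> H i" using i True by (intro young[OF True] permutes_subset[OF h(1)]) (auto simp: S_def)
    thus ?thesis
      using coset_mult_closed[OF subJ[OF i] gc[OF i], of x2 h] i True x2(2)
      by (simp add: C_def sym_group_mult)
  next
    case False
    hence iL: "i \<in> L" using i J by blast
    have "(h \<circ> x2) ` B i = h ` x2 ` B i" by (simp add: image_comp)
    also have "\<dots> = f ` x2 ` B i" using h(2) i iL unfolding U_def by (intro image_cong) auto
    also have "\<dots> = Y i" using fx2 x1(2) i iL by simp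
    finally show ?thesis using CL[OF i iL xp] by blast
  qed
  thus "\<exists>x\<in>carrier (sym_group n). \<forall>i\<in>J. x \<in> H i #>\<^bsub>sym_group n\<^esub> g i"
    using xp by (intro bexI[of _ "h \<circ> x2"]) (auto simp: C_def sym_group_carrier)
qed

section \<open>Trees of transpositions\<close>

locale tree_graph =
  fixes n :: nat and \<rho> :: "nat \<Rightarrow> nat \<Rightarrow> nat" and \<Gamma> :: "nat \<Rightarrow> (nat \<Rightarrow> nat) set"
    and V :: "nat set" and e :: "nat \<Rightarrow> nat set" and t a\<^sub>1 a\<^sub>2 a\<^sub>3 :: nat
  assumes n: "n \<ge> 5"
    and V: "V \<subseteq> {1..n}" "{1..n} - V = {a\<^sub>1, a\<^sub>2, a\<^sub>3}" and dist: "distinct [a\<^sub>1, a\<^sub>2, a\<^sub>3]"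
    and edge: "\<And>k. k \<in> {2..n - 3} \<Longrightarrow> \<exists>x\<in>V. \<exists>y\<in>V. x \<noteq> y \<and> e k = {x, y} \<and> \<rho> k = transpose x y"
    and conn: "\<And>u v. u \<in> V \<Longrightarrow> v \<in> V \<Longrightarrow> (u, v) \<in> {(x, y). {x, y} \<in> e ` {2..n - 3}}\<^sup>*"
    and t: "t \<in> V" and leaf: "\<And>k. k \<in> {2..n - 3} \<Longrightarrow> t \<in> e k \<longleftrightarrow> k = 2"
    and perm01: "\<And>i. i \<in> {0, 1} \<Longrightarrow> \<rho> i permutes {1..n}"
    and \<Gamma>: "\<And>i. i \<in> {0..n - 3} \<Longrightarrow>
               \<Gamma> i = generate (sym_group n) {\<rho> j | j. j \<in> {0..n - 3} \<and> j \<noteq> i}"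
begin

text \<open>For \<open>i\<close> equal to 0 or 1 no edge is deleted and \<open>R i\<close> is the
  full adjacency of the tree, so one relation serves all the groups.\<close>

definition R :: "nat \<Rightarrow> (nat \<times> nat) set" where
  "R i = {(x, y). \<exists>k\<in>{2..n - 3}. k \<noteq> i \<and> e k = {x, y}}"

text \<open>The vertices on the side of \<open>t\<close> after deleting the edge \<open>e i\<close>, and those cut off from \<open>t\<close>.\<close>

definition X :: "nat \<Rightarrow> nat set" where
  "X i = {v \<in> V. (t, v) \<in> (R i)\<^sup>*}"

definition Y :: "nat \<Rightarrow> nat set" where
  "Y i = V - X i"

lemma edge_subset: "k \<in> {2..n - 3} \<Longrightarrow> e k \<subseteq> V"
  using edge[of k] by auto

lemma transpose_edge: "k \<in> {2..n - 3} \<Longrightarrow> e k = {x, y} \<Longrightarrow> \<rho> k = transpose x y"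
  using edge[of k] by (auto simp: doubleton_eq_iff transpose_commute)

lemma perm: "i \<in> {0..n - 3} \<Longrightarrow> \<rho> i permutes {1..n}"
proof (cases "i \<in> {0, 1}")
  case False
  assume "i \<in> {0..n - 3}"
  then obtain x y where "x \<in> V" "y \<in> V" "\<rho> i = transpose x y"
    using edge[of i] False by auto
  thus ?thesis using V(1) by (auto intro!: permutes_swap_id)
qed (rule perm01)

lemma perm_gens: "{\<rho> j | j. j \<in> {0..n - 3} \<and> j \<noteq> i} \<subseteq> carrier (sym_group n)"
  using perm by (auto simp: sym_group_carrier)

lemma sub: "i \<in> {0..n - 3} \<Longrightarrow> subgroup (\<Gamma> i) (sym_group n)"
  using group.generate_is_subgroup[OF sym_group_is_group perm_gens] \<Gamma> by simp

lemma gen: "i \<in> {0..n - 3} \<Longrightarrow> j \<in> {0..n - 3} \<Longrightarrow> j \<noteq> i \<Longrightarrow> \<rho> j \<in> \<Gamma> i"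
  unfolding \<Gamma> by (rule generate.incl) auto

lemma \<Gamma>_preserves:
  assumes "i \<in> {0..n - 3}" "\<And>j. j \<in> {0..n - 3} \<Longrightarrow> j \<noteq> i \<Longrightarrow> (`) (\<rho> j) ` Q = Q" "p \<in> \<Gamma> i"
  shows "(`) p ` Q = Q"
proof (rule generate_preserves)
  show "p \<in> generate (sym_group n) {\<rho> j | j. j \<in> {0..n - 3} \<and> j \<noteq> i}"
    using assms(1,3) \<Gamma> by blast
  show "x permutes {1..n} \<and> (`) x ` Q = Q" if "x \<in> {\<rho> j | j. j \<in> {0..n - 3} \<and> j \<noteq> i}" for x
    using that assms(2) perm by blast
qed

lemma edge_image:
  assumes "k \<in> {2..n - 3}" "e k \<subseteq> A \<or> e k \<inter> A = {}"
  shows "\<rho> k ` A = A"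
proof -
  obtain x y where "e k = {x, y}" "\<rho> k = transpose x y" using edge[OF assms(1)] by blast
  moreover from this have "x \<in> A \<longleftrightarrow> y \<in> A" using assms(2) by auto
  ultimately show ?thesis by simp
qed

section \<open>Connectivity of the tree after deleting one edge\<close>

lemma R_sym: "(u, v) \<in> (R i)\<^sup>* \<Longrightarrow> (v, u) \<in> (R i)\<^sup>*"
proof (rule symD[OF sym_rtrancl[OF symI]])
  show "(y, x) \<in> R i" if "(x, y) \<in> R i" for x y
    using that unfolding R_def by (simp add: insert_commute)
qed

lemma R_transpose:
  assumes "i \<in> {0..n - 3}" "(u, v) \<in> (R i)\<^sup>*"
  shows "transpose u v \<in> \<Gamma> i"
  using assms(2)
proof induction
  case base
  have "transpose u u = id" by simp
  thus ?case using subgroup_id[OF sub[OF assms(1)]] by metis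
next
  case (step v w)
  then obtain k where "k \<in> {2..n - 3}" "k \<noteq> i" "e k = {v, w}" unfolding R_def by blast
  hence "transpose v w \<in> \<Gamma> i" using transpose_edge gen[OF assms(1), of k] by simp
  thus ?case using subgroup_transpose_trans[OF sub[OF assms(1)] step.IH] by blast
qed

lemma edge_side:
  assumes "k \<in> {2..n - 3}" "k \<noteq> j"
  shows "e k \<subseteq> X j \<or> e k \<subseteq> Y j"
proof -
  obtain x y where xy: "x \<in> V" "y \<in> V" "e k = {x, y}" using edge[OF assms(1)] by blast
  hence "(x, y) \<in> R j" "(y, x) \<in> R j" using assms unfolding R_def by (auto simp: insert_commute)
  hence "(t, x) \<in> (R j)\<^sup>* \<longleftrightarrow> (t, y) \<in> (R j)\<^sup>*" by (meson rtrancl.rtrancl_into_rtrancl)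
  thus ?thesis using xy unfolding X_def Y_def by auto
qed

text \<open>Without the edge \<open>j\<close> every vertex is still joined to one of its ends. The
  end joined to \<open>t\<close> cannot be joined to a vertex of \<open>Y j\<close>, so all of
  \<open>Y j\<close> hangs on the other end.\<close>

lemma Y_connected:
  assumes "j \<in> {2..n - 3}" "u \<in> Y j" "v \<in> Y j"
  shows "(u, v) \<in> (R j)\<^sup>*"
proof -
  obtain p q where pq: "p \<in> V" "q \<in> V" "e j = {p, q}" using edge[OF assms(1)] by blast
  have reach: "(p, w) \<in> (R j)\<^sup>* \<or> (q, w) \<in> (R j)\<^sup>*" if "w \<in> V" for w
    using conn[OF pq(1) that]
  proof induction
    case (step x y)
    then obtain k where k: "k \<in> {2..n - 3}" "e k = {x, y}" by auto
    show ?case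
    proof (cases "k = j")
      case True
      thus ?thesis using k pq(3) by (auto simp: doubleton_eq_iff)
    next
      case False
      hence "(x, y) \<in> R j" using k unfolding R_def by auto
      thus ?thesis using step.IH by (meson rtrancl.rtrancl_into_rtrancl)
    qed
  qed simp
  have tr: "(x, z) \<in> (R j)\<^sup>*" if "(y, x) \<in> (R j)\<^sup>*" "(y, z) \<in> (R j)\<^sup>*" for x y z
    using R_sym[OF that(1)] that(2) by (rule rtrancl_trans)
  have "u \<in> V" "v \<in> V" "(t, u) \<notin> (R j)\<^sup>*" "(t, v) \<notin> (R j)\<^sup>*"
    using assms unfolding Y_def X_def by auto
  thus ?thesis using reach[of u] reach[of v] reach[OF t] tr by meson
qed

text \<open>A path from \<open>t\<close> avoiding the edge \<open>j\<close> stays in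
  \<open>X j\<close> and therefore never uses an edge inside \<open>Y j\<close>.\<close>

lemma X_subset:
  assumes "k \<in> {2..n - 3}" "e k \<subseteq> Y j"
  shows "X j \<subseteq> X k"
proof
  fix v assume v: "v \<in> X j"
  hence "(t, v) \<in> (R j)\<^sup>*" unfolding X_def by blast
  hence "(t, v) \<in> (R k)\<^sup>*"
  proof induction
    case (step x y)
    then obtain m where m: "m \<in> {2..n - 3}" "m \<noteq> j" "e m = {x, y}" unfolding R_def by blast
    have "x \<in> X j" using step.hyps(1) m edge_subset[of m] unfolding X_def by auto
    hence "m \<noteq> k" using assms(2) m(3) unfolding Y_def by blast
    hence "(x, y) \<in> R k" using m unfolding R_def by blast
    thus ?case using step.IH by (meson rtrancl.rtrancl_into_rtrancl)
  qed simp
  thus "v \<in> X k" using v unfolding X_def by blast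
qed

text \<open>If the edge \<open>k\<close> is cut off by \<open>j\<close>, whatever \<open>k\<close>
  cuts off is cut off by \<open>j\<close> too. Otherwise \<open>k\<close> lies on the side of
  \<open>t\<close>; then \<open>Y j\<close> is connected without using \<open>k\<close> and falls
  entirely on one side of \<open>k\<close>.\<close>

lemma Y_laminar:
  assumes "j \<in> {2..n - 3}" "k \<in> {2..n - 3}"
  shows "Y j \<subseteq> Y k \<or> Y k \<subseteq> Y j \<or> Y j \<inter> Y k = {}"
proof -
  have "Y j \<subseteq> Y k \<or> Y j \<inter> Y k = {}" if kX: "e k \<subseteq> X j" "k \<noteq> j"
  proof -
    have "(u, v) \<in> (R k)\<^sup>*" if u: "u \<in> Y j" and v: "v \<in> Y j" for u v
      using Y_connected[OF assms(1) u v]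
    proof induction
      case (step x y)
      then obtain m where m: "m \<in> {2..n - 3}" "m \<noteq> j" "e m = {x, y}" unfolding R_def by blast
      have "x \<notin> X j"
      proof
        assume "x \<in> X j"
        hence "(t, u) \<in> (R j)\<^sup>*"
          using R_sym[OF step.hyps(1)] unfolding X_def by (auto intro: rtrancl_trans)
        thus False using u unfolding Y_def X_def by blast
      qed
      hence "m \<noteq> k" using kX m(3) by blast
      hence "(x, y) \<in> R k" using m unfolding R_def by blast
      thus ?case using step.IH by (meson rtrancl.rtrancl_into_rtrancl)
    qed simp
    hence "u \<in> Y k \<Longrightarrow> v \<in> Y k" if "u \<in> Y j" "v \<in> Y j" for u v
      using that R_sym rtrancl_trans[of t v "R k" u] unfolding Y_def X_def by blast
    thus ?thesis by blast
  qed
  moreover have "Y k \<subseteq> Y j" if "e k \<subseteq> Y j"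
    using X_subset[OF assms(2) that] unfolding Y_def by blast
  ultimately show ?thesis using edge_side[OF assms(2), of j] by blast
qed

lemma Y_2: "Y 2 = V - {t}"
proof -
  have "v = t" if "(t, v) \<in> (R 2)\<^sup>*" for v
    using that
  proof (rule converse_rtranclE)
    fix w assume "(t, w) \<in> R 2"
    then obtain k where "k \<in> {2..n - 3}" "k \<noteq> 2" "e k = {t, w}" unfolding R_def by blast
    thus ?thesis using leaf[of k] by simp
  qed simp
  hence "X 2 = {t}" using t unfolding X_def by auto
  thus ?thesis by (simp add: Y_def)
qed

section \<open>Invariants of the three exceptional groups\<close>

lemma \<Gamma>_0_1_preserves:
  assumes "i \<in> {0, 1}" "A \<subseteq> {a\<^sub>1, a\<^sub>2, a\<^sub>3}" "\<rho> (1 - i) ` A = A" "p \<in> \<Gamma> i"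
  shows "p ` A = A"
proof -
  have "(`) p ` {A} = {A}"
  proof (rule \<Gamma>_preserves[OF _ _ assms(4)])
    show "(`) (\<rho> j) ` {A} = {A}" if j: "j \<in> {0..n - 3}" "j \<noteq> i" for j
    proof (cases "j \<in> {0, 1}")
      case True
      hence "j = 1 - i" using j(2) assms(1) by auto
      thus ?thesis using assms(3) by simp
    next
      case False
      hence j': "j \<in> {2..n - 3}" using j(1) by auto
      have "e j \<inter> A = {}" using edge_subset[OF j'] V(2) assms(2) by blast
      thus ?thesis using edge_image[OF j'] by simp
    qed
  qed (use n assms(1) in auto)
  thus ?thesis by simp
qed

text \<open>With label 2 removed, no remaining tree edge touches \<open>t\<close>, so only
  \<open>\<rho> 0\<close> and \<open>\<rho> 1\<close> can move the four points.\<close>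

lemma \<Gamma>_2_preserves:
  assumes "\<Union>Q \<subseteq> {a\<^sub>1, a\<^sub>2, a\<^sub>3, t}" "(`) (\<rho> 0) ` Q = Q" "(`) (\<rho> 1) ` Q = Q" "p \<in> \<Gamma> 2"
  shows "(`) p ` Q = Q"
proof (rule \<Gamma>_preserves[OF _ _ assms(4)])
  show "(`) (\<rho> j) ` Q = Q" if j: "j \<in> {0..n - 3}" "j \<noteq> 2" for j
  proof (cases "j \<in> {0, 1}")
    case False
    hence j': "j \<in> {2..n - 3}" using j(1) by auto
    have "e j \<inter> {a\<^sub>1, a\<^sub>2, a\<^sub>3, t} = {}"
      using edge_subset[OF j'] leaf[OF j'] j(2) V(2) by auto
    hence "\<rho> j ` A = A" if "A \<in> Q" for A
      using edge_image[OF j', of A] that assms(1) by blast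
    thus ?thesis by simp
  qed (use assms(2,3) in auto)
qed (use n in auto)

lemma leaf_edge:
  obtains s where "s \<in> V" "s \<noteq> t" "\<rho> 2 = transpose t s"
proof -
  have 2: "2 \<in> {2..n - 3}" using n by simp
  obtain x y where "x \<in> V" "y \<in> V" "x \<noteq> y" "e 2 = {x, y}" "\<rho> 2 = transpose x y"
    using edge[OF 2] by blast
  moreover from this have "t = x \<or> t = y" using leaf[OF 2] by auto
  ultimately show thesis using that by (auto simp: transpose_commute)
qed

lemma t_connected: "v \<in> V \<Longrightarrow> i \<in> {0, 1} \<Longrightarrow> (t, v) \<in> (R i)\<^sup>*"
proof -
  assume "v \<in> V" "i \<in> {0, 1}"
  moreover from this have "{(x, y). {x, y} \<in> e ` {2..n - 3}} \<subseteq> R i" unfolding R_def by fastforce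
  ultimately show ?thesis using conn[OF t, of v] rtrancl_mono by blast
qed

end

text \<open>These are the conditions in which the three types differ. The index \<open>1 - i\<close>
  exchanges 0 and 1, so \<open>\<rho> (1 - i)\<close> is the one non-tree generator of
  \<open>\<Gamma> i\<close>. \<open>star\<close> and \<open>star_W\<close> attach further points to
  \<open>t\<close> by transpositions. Since \<open>\<rho> 0\<close> and \<open>\<rho> 1\<close> are
  involutions, \<open>factor\<close> says that \<open>b \<circ> a\<close> acts on the four points as
  \<open>\<alpha> \<circ> \<beta>\<close>.\<close>

locale top_graph = tree_graph +
  fixes W :: "nat \<Rightarrow> nat set"
  assumes top_perm: "\<And>i. i \<in> {0, 1} \<Longrightarrow> \<rho> i permutes {a\<^sub>1, a\<^sub>2, a\<^sub>3, t}"
    and invol: "\<And>i. i \<in> {0, 1} \<Longrightarrow> \<rho> i \<circ> \<rho> i = id"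
    and W_subset: "\<And>i. i \<in> {0, 1} \<Longrightarrow> W i \<subseteq> {a\<^sub>1, a\<^sub>2, a\<^sub>3}"
    and W_2: "W 2 = {a\<^sub>1, a\<^sub>2, a\<^sub>3, t}"
    and W_inv: "\<And>i. i \<in> {0, 1} \<Longrightarrow> \<rho> (1 - i) ` W i = W i"
    and star: "\<And>M s x. subgroup M (sym_group n) \<Longrightarrow> \<rho> 0 \<in> M \<Longrightarrow> \<rho> 1 \<in> M \<Longrightarrow>
        s \<notin> {a\<^sub>1, a\<^sub>2, a\<^sub>3, t} \<Longrightarrow> transpose t s \<in> M \<Longrightarrow> x \<in> {a\<^sub>1, a\<^sub>2, a\<^sub>3} \<Longrightarrow> transpose x t \<in> M"
    and star_W: "\<And>M s x i. subgroup M (sym_group n) \<Longrightarrow> i \<in> {0, 1} \<Longrightarrow> \<rho> (1 - i) \<in> M \<Longrightarrow>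
        s \<notin> {a\<^sub>1, a\<^sub>2, a\<^sub>3, t} \<Longrightarrow> transpose t s \<in> M \<Longrightarrow> x \<in> {a\<^sub>1, a\<^sub>2, a\<^sub>3} - W i \<Longrightarrow>
        transpose x t \<in> M"
    and factor: "\<And>a b. a \<in> \<Gamma> 0 \<Longrightarrow> b \<in> \<Gamma> 1 \<Longrightarrow> b \<circ> a \<in> \<Gamma> 2 \<Longrightarrow>
        \<exists>\<alpha>\<in>{id, \<rho> 0}. \<exists>\<beta>\<in>{id, \<rho> 1}. \<forall>w\<in>{a\<^sub>1, a\<^sub>2, a\<^sub>3, t}. (\<alpha> \<circ> (b \<circ> a) \<circ> \<beta>) w = w"
begin

lemma V_top:
  "V \<inter> {a\<^sub>1, a\<^sub>2, a\<^sub>3, t} = {t}" "{1..n} = V \<union> {a\<^sub>1, a\<^sub>2, a\<^sub>3}" "V \<inter> {a\<^sub>1, a\<^sub>2, a\<^sub>3} = {}"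
  using V t by auto

lemma Y_top: "Y j \<inter> {a\<^sub>1, a\<^sub>2, a\<^sub>3, t} = {}"
proof -
  have "t \<in> X j" using t unfolding X_def by simp
  thus ?thesis using V_top(3) unfolding Y_def by auto
qed

lemma top_preserves:
  assumes "i \<in> {0, 1}" "A \<inter> {a\<^sub>1, a\<^sub>2, a\<^sub>3, t} = {}"
  shows "\<rho> i ` A = A"
proof -
  have "\<rho> i x = x" if "x \<in> A" for x
    using permutes_not_in[OF top_perm[OF assms(1)]] assms(2) that by blast
  thus ?thesis by force
qed

lemma W_preserved:
  assumes "k \<in> {0, 1, 2}" "p \<in> \<Gamma> k"
  shows "p ` W k = W k"
proof (cases "k = 2")
  case True
  have "\<rho> i ` W 2 = W 2" if "i \<in> {0, 1}" for i
    using permutes_image[OF top_perm[OF that]] unfolding W_2 .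
  hence w: "(`) (\<rho> 0) ` {W 2} = {W 2}" "(`) (\<rho> 1) ` {W 2} = {W 2}" by simp_all
  have "\<Union>{W 2} \<subseteq> {a\<^sub>1, a\<^sub>2, a\<^sub>3, t}" using W_2 by simp
  hence "(`) p ` {W 2} = {W 2}" using w assms(2)[unfolded True] by (rule \<Gamma>_2_preserves)
  thus ?thesis using True by simp
next
  case False
  hence "k \<in> {0, 1}" using assms(1) by blast
  thus ?thesis using \<Gamma>_0_1_preserves[OF _ W_subset W_inv assms(2)] by blast
qed

text \<open>For \<open>k = 2\<close> the points off \<open>W 2\<close> form \<open>Y 2\<close>,
  which is connected without the edge 2. For the other two labels a star of transpositions centred
  at \<open>t\<close> suffices: the tree supplies the arms to its vertices, \<open>star_W\<close>
  the remaining ones.\<close>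

lemma young:
  assumes "k \<in> {0, 1, 2}" "p permutes {1..n} - W k"
  shows "p \<in> \<Gamma> k"
proof (cases "k = 2")
  case True
  have 2: "2 \<in> {2..n - 3}" "2 \<in> {0..n - 3}" using n by auto
  have "{1..n} - W k = Y 2" using V_top V(2) unfolding Y_2 True W_2 by blast
  thus ?thesis
    using subgroup_if_transposes[OF sub[OF 2(2)] R_transpose[OF 2(2) Y_connected[OF 2(1)]] _
        assms(2)[unfolded True]] True
    by (metis finite_Diff finite_atLeastAtMost)
next
  case False
  hence k: "k \<in> {0, 1}" "k \<in> {0..n - 3}" using assms(1) n by auto
  obtain s where s: "s \<in> V" "s \<noteq> t" "\<rho> 2 = transpose t s" by (rule leaf_edge)
  have sM: "transpose t s \<in> \<Gamma> k" using gen[OF k(2), of 2] n k(1) s(3) by auto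
  have st: "s \<notin> {a\<^sub>1, a\<^sub>2, a\<^sub>3, t}" using s V_top(1) by blast
  have rM: "\<rho> (1 - k) \<in> \<Gamma> k" using k n by (intro gen) auto
  have "transpose x t \<in> \<Gamma> k" if "x \<in> {1..n} - W k" for x
  proof (cases "x \<in> V")
    case True
    thus ?thesis using R_transpose[OF k(2) R_sym[OF t_connected[OF True k(1)]]] by blast
  next
    case False
    thus ?thesis using star_W[OF sub[OF k(2)] k(1) rM st sM] that V_top(2) by blast
  qed
  thus ?thesis
    using subgroup_if_star[OF sub[OF k(2)] _ _ assms(2)] by blast
qed

lemma Y_preserved:
  assumes j: "j \<in> {3..n - 3}" and p: "p \<in> \<Gamma> j"
  shows "p ` Y j = Y j"
proof -
  have "\<rho> i ` Y j = Y j" if i: "i \<in> {0..n - 3}" "i \<noteq> j" for i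
  proof (cases "i \<in> {0, 1}")
    case True
    thus ?thesis by (rule top_preserves) (rule Y_top)
  next
    case False
    hence "i \<in> {2..n - 3}" using i(1) by auto
    thus ?thesis using edge_side[of i j] i(2) by (intro edge_image) (auto simp: Y_def)
  qed
  hence "(`) p ` {Y j} = {Y j}" using j by (intro \<Gamma>_preserves[OF _ _ p]) simp_all
  thus ?thesis by simp
qed

text \<open>\<open>\<Gamma> j\<close> contains both full symmetric factors: on \<open>Y j\<close> by
  connectivity, on the complement by a star at \<open>t\<close> whose arms outside the tree come
  from \<open>star\<close>.\<close>

lemma \<Gamma>_stabilizer:
  assumes j: "j \<in> {3..n - 3}"
  shows "\<Gamma> j = {p. p permutes {1..n} \<and> p ` Y j = Y j}"
proof -
  have j': "j \<in> {2..n - 3}" "j \<in> {0..n - 3}" using j by auto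
  note M = sub[OF j'(2)]
  obtain s where s: "s \<in> V" "s \<noteq> t" "\<rho> 2 = transpose t s" by (rule leaf_edge)
  have sM: "transpose t s \<in> \<Gamma> j" using gen[OF j'(2), of 2] n j s(3) by auto
  have st: "s \<notin> {a\<^sub>1, a\<^sub>2, a\<^sub>3, t}" using s V_top(1) by blast
  have rM: "\<rho> 0 \<in> \<Gamma> j" "\<rho> 1 \<in> \<Gamma> j" using j n by (auto intro!: gen)
  have YS: "Y j \<subseteq> {1..n}" using V(1) unfolding Y_def by blast
  have YM: "p \<in> \<Gamma> j" if "p permutes Y j" for p
    using subgroup_if_transposes[OF M R_transpose[OF j'(2) Y_connected[OF j'(1)]] _ that]
      finite_subset[OF YS] by blast
  have "transpose x t \<in> \<Gamma> j" if "x \<in> {1..n} - Y j" for x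
  proof (cases "x \<in> V")
    case True
    hence "(t, x) \<in> (R j)\<^sup>*" using that unfolding Y_def X_def by blast
    thus ?thesis using R_transpose[OF j'(2) R_sym] by blast
  next
    case False
    thus ?thesis using star[OF M rM st sM] that V_top(2) by blast
  qed
  hence XM: "p \<in> \<Gamma> j" if "p permutes {1..n} - Y j" for p
    using subgroup_if_star[OF M _ _ that] by blast
  show ?thesis
    using stabilizer_subset_if_parts[OF M YS YM XM] Y_preserved[OF j] subgroup_permutes[OF M] by blast
qed

lemma helly_top: "coset_helly (sym_group n) \<Gamma> {0, 1, 2}"
proof (rule group.coset_helly_three[OF sym_group_is_group])
  have I: "0 \<in> {0..n - 3}" "1 \<in> {0..n - 3}" "2 \<in> {0..n - 3}" using n by auto
  show subs: "subgroup (\<Gamma> 0) (sym_group n)" "subgroup (\<Gamma> 1) (sym_group n)" "subgroup (\<Gamma> 2) (sym_group n)"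
    using sub I by auto
  fix a b assume a: "a \<in> \<Gamma> 0" and b: "b \<in> \<Gamma> 1" and ba: "b \<otimes>\<^bsub>sym_group n\<^esub> a \<in> \<Gamma> 2"
  define g where "g = b \<circ> a"
  have g: "g \<in> \<Gamma> 2" using ba by (simp add: g_def sym_group_mult)
  obtain \<alpha> \<beta> where ab: "\<alpha> \<in> {id, \<rho> 0}" "\<beta> \<in> {id, \<rho> 1}"
    and fixed: "\<And>w. w \<in> W 2 \<Longrightarrow> (\<alpha> \<circ> g \<circ> \<beta>) w = w"
    using factor[OF a b] g unfolding g_def W_2 by blast
  have \<alpha>: "\<alpha> \<in> \<Gamma> 1" "\<alpha> \<in> \<Gamma> 2" "\<alpha> \<circ> \<alpha> = id"
    using ab(1) subgroup_id[OF subs(2)] subgroup_id[OF subs(3)] gen[OF I(2) I(1)]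
      gen[OF I(3) I(1)] invol[of 0]
    by (auto simp: comp_def)
  have \<beta>: "\<beta> \<in> \<Gamma> 0" "\<beta> \<in> \<Gamma> 2" "\<beta> \<circ> \<beta> = id"
    using ab(2) subgroup_id[OF subs(1)] subgroup_id[OF subs(3)] gen[OF I(1) I(2)]
      gen[OF I(3) I(2)] invol[of 1]
    by (auto simp: comp_def)
  \<comment> \<open>\<open>s\<close> fixes all four points, hence lies in all three groups by
    \<open>young\<close>. As \<open>\<alpha>\<close> and \<open>\<beta>\<close> are their own
    inverses, \<open>g\<close> is \<open>(\<alpha> \<circ> s) \<circ> \<beta>\<close>, with
    \<open>\<alpha>\<close> outside the reach of label 1 and \<open>\<beta>\<close> outside that of
    label 0.\<close>
  define s where "s = \<alpha> \<circ> g \<circ> \<beta>"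
  have "s \<in> \<Gamma> 2" unfolding s_def using \<alpha> \<beta> g subgroup_comp[OF subs(3)] by blast
  hence "s permutes {1..n}" using subgroup_permutes[OF subs(3)] by blast
  hence s: "s permutes {1..n} - W 2"
    using fixed unfolding s_def by (rule permutes_superset) blast
  moreover have "W k \<subseteq> W 2" if "k \<in> {0, 1, 2}" for k using that W_subset[of k] W_2 by auto
  ultimately have sG: "s \<in> \<Gamma> k" if "k \<in> {0, 1, 2}" for k
    using young[OF that] permutes_subset[OF s] that by (meson Diff_mono order_refl)
  have "(\<alpha> \<circ> s) \<circ> \<beta> = (\<alpha> \<circ> \<alpha>) \<circ> g \<circ> (\<beta> \<circ> \<beta>)" by (simp add: s_def comp_assoc)
  hence "(\<alpha> \<circ> s) \<circ> \<beta> = g" using \<alpha>(3) \<beta>(3) by simp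
  moreover have "\<alpha> \<circ> s \<in> \<Gamma> 1 \<inter> \<Gamma> 2"
    using subgroup_comp[OF subs(2) \<alpha>(1) sG] subgroup_comp[OF subs(3) \<alpha>(2) sG] by blast
  ultimately show "\<exists>b'\<in>\<Gamma> 1 \<inter> \<Gamma> 2. \<exists>a'\<in>\<Gamma> 0 \<inter> \<Gamma> 2.
      b \<otimes>\<^bsub>sym_group n\<^esub> a = b' \<otimes>\<^bsub>sym_group n\<^esub> a'"
    using \<beta>(1,2) unfolding g_def sym_group_mult by (metis IntI)
qed

lemma flag_transitive_\<Gamma>: "flag_transitive (sym_group n) \<Gamma> {0..n - 3}"
proof (rule group.coset_helly_imp_flag_transitive[OF sym_group_is_group])
  have I: "{0..n - 3} = {3..n - 3} \<union> {0, 1, 2}" using n by auto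
  show "coset_helly (sym_group n) \<Gamma> {0..n - 3}"
    unfolding I
  proof (rule coset_helly_combine[where Y = Y and W = W])
    show "subgroup (\<Gamma> i) (sym_group n)" if "i \<in> {3..n - 3} \<union> {0, 1, 2}" for i
      using sub that I by blast
    show "Y j \<subseteq> {1..n}" for j using V(1) unfolding Y_def by blast
    show "Y i \<subseteq> Y j \<or> Y j \<subseteq> Y i \<or> Y i \<inter> Y j = {}" if "i \<in> {3..n - 3}" "j \<in> {3..n - 3}" for i j
      using Y_laminar that by simp
    show "Y j \<inter> W k = {}" if "k \<in> {0, 1, 2}" for j k
    proof -
      have "W k \<subseteq> {a\<^sub>1, a\<^sub>2, a\<^sub>3, t}" using that W_subset[of k] W_2 by auto
      thus ?thesis using Y_top[of j] by blast
    qed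
  qed (use \<Gamma>_stabilizer W_preserved young helly_top in auto)
qed (rule sub)

end

section \<open>The three types\<close>

text \<open>The dihedral group of order 8 acting on the path \<open>p, q, r, s\<close> is the stabilizer of the pairing
  \<open>q r | p s\<close>, and its two reflections \<open>(q r)\<close> and \<open>(p q)(r s)\<close> generate it.\<close>

lemma dihedral_factor:
  assumes d: "distinct [p, q, r, s]" and Q: "(`) g ` {{q, r}, {p, s}} = {{q, r}, {p, s}}"
    and p: "g p = p \<or> g q = p"
  shows "\<exists>\<alpha>\<in>{id, transpose q r}. \<exists>\<beta>\<in>{id, transpose p q \<circ> transpose r s}.
           \<forall>w\<in>{p, q, r, s}. (\<alpha> \<circ> g \<circ> \<beta>) w = w"
proof -
  have "{{g q, g r}, {g p, g s}} = {{q, r}, {p, s}}" using Q by simp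
  hence "({g q, g r} = {q, r} \<and> {g p, g s} = {p, s}) \<or> ({g q, g r} = {p, s} \<and> {g p, g s} = {q, r})"
    by (rule doubleton_eq_iff[THEN iffD1])
  \<comment> \<open>Eight permutations of the four points preserve the pairing; in half of them the
    preimage of \<open>p\<close> is \<open>p\<close> or \<open>q\<close>. These four are exactly the
    products \<open>\<alpha> \<circ> \<beta>\<close>.\<close>
  then consider "g p = p \<and> g q = q \<and> g r = r \<and> g s = s" | "g p = p \<and> g q = r \<and> g r = q \<and> g s = s"
    | "g p = q \<and> g q = p \<and> g r = s \<and> g s = r" | "g p = r \<and> g q = p \<and> g r = s \<and> g s = q"
    using d p by (auto simp: doubleton_eq_iff)
  thus ?thesis
    using d by cases (auto simp: transpose_def)
qed

lemma klein_factor: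
  assumes d: "distinct [p, q, r, s]" and Q: "(`) g ` {{p, q}, {r, s}} = {{p, q}, {r, s}}"
    and Q': "(`) g ` {{p, r}, {q, s}} = {{p, r}, {q, s}}"
  shows "\<exists>\<alpha>\<in>{id, transpose p q \<circ> transpose r s}. \<exists>\<beta>\<in>{id, transpose p r \<circ> transpose q s}.
           \<forall>w\<in>{p, q, r, s}. (\<alpha> \<circ> g \<circ> \<beta>) w = w"
proof -
  have "{{g p, g q}, {g r, g s}} = {{p, q}, {r, s}}" using Q by simp
  hence 1: "({g p, g q} = {p, q} \<and> {g r, g s} = {r, s}) \<or> ({g p, g q} = {r, s} \<and> {g r, g s} = {p, q})"
    by (rule doubleton_eq_iff[THEN iffD1])
  have "{{g p, g r}, {g q, g s}} = {{p, r}, {q, s}}" using Q' by simp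
  hence 2: "({g p, g r} = {p, r} \<and> {g q, g s} = {q, s}) \<or> ({g p, g r} = {q, s} \<and> {g q, g s} = {p, r})"
    by (rule doubleton_eq_iff[THEN iffD1])
  \<comment> \<open>Preserving two of the three pairings of four points forces preserving the third,
    which leaves the Klein four-group: the products \<open>\<alpha> \<circ> \<beta>\<close>.\<close>
  consider "g p = p \<and> g q = q \<and> g r = r \<and> g s = s" | "g p = q \<and> g q = p \<and> g r = s \<and> g s = r"
    | "g p = r \<and> g q = s \<and> g r = p \<and> g s = q" | "g p = s \<and> g q = r \<and> g r = q \<and> g s = p"
    using d 1 2 by (auto simp: doubleton_eq_iff)
  thus ?thesis
    using d by cases (auto simp: transpose_def)
qed

lemma double_transpose:
  assumes "distinct [x, y, z, w]"
  shows "(transpose x y \<circ> transpose z w) x = y" "(transpose x y \<circ> transpose z w) y = x"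
    "(transpose x y \<circ> transpose z w) z = w" "(transpose x y \<circ> transpose z w) w = z"
    and "(transpose x y \<circ> transpose z w) \<circ> (transpose x y \<circ> transpose z w) = id"
    and "transpose x y \<circ> transpose z w permutes {x, y, z, w}"
proof -
  show "transpose x y \<circ> transpose z w permutes {x, y, z, w}"
    by (intro permutes_compose[OF permutes_swap_id permutes_swap_id]) auto
qed (use assms in \<open>auto simp: transpose_def fun_eq_iff\<close>)

text \<open>This extracts from membership in the product of \<open>\<Gamma> 1\<close> and
  \<open>\<Gamma> 0\<close> the condition that selects half of the dihedral group.\<close>

lemma comp_image_or:
  assumes "b p = p" "a ` {p, q} = {p, q}"
  shows "(b \<circ> a) p = p \<or> (b \<circ> a) q = p"
proof -
  have "p \<in> a ` {p, q}" using assms(2) by simp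
  thus ?thesis using assms(1) by auto
qed

section \<open>Verification of the four-point conditions for each type\<close>

context tree_graph
begin

lemma top_distinct: "distinct [a\<^sub>1, a\<^sub>2, a\<^sub>3, t]"
  using V(2) t dist by auto

lemma \<Gamma>_2_preserves_pair:
  assumes "A \<union> B \<subseteq> {a\<^sub>1, a\<^sub>2, a\<^sub>3, t}" "{\<rho> 0 ` A, \<rho> 0 ` B} = {A, B}"
    "{\<rho> 1 ` A, \<rho> 1 ` B} = {A, B}" "p \<in> \<Gamma> 2"
  shows "(`) p ` {A, B} = {A, B}"
proof (rule \<Gamma>_2_preserves[OF _ _ _ assms(4)])
  show "\<Union>{A, B} \<subseteq> {a\<^sub>1, a\<^sub>2, a\<^sub>3, t}" using assms(1) by simp
qed (unfold image_insert image_empty, (rule assms)+)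

lemma split_top:
  assumes "subgroup M (sym_group n)" "s \<notin> {a\<^sub>1, a\<^sub>2, a\<^sub>3, t}" "transpose t s \<in> M"
    and "distinct [x, y, z]" "{x, y, z} = {a\<^sub>1, a\<^sub>2, a\<^sub>3}" "transpose x y \<circ> transpose z t \<in> M"
  shows "transpose x y \<in> M" "transpose z t \<in> M"
proof -
  have "t \<notin> {x, y, z}" "s \<notin> {x, y, z, t}" using assms(2,5) top_distinct by auto
  hence "distinct [x, y, z, t, s]" using assms(4) by auto
  thus "transpose x y \<in> M" "transpose z t \<in> M"
    using subgroup_split_double_transpose assms(1,3,6) by blast+
qed


lemma flag_transitive_A:
  assumes r0: "\<rho> 0 = transpose a\<^sub>2 a\<^sub>3" and r1: "\<rho> 1 = transpose a\<^sub>1 a\<^sub>2 \<circ> transpose a\<^sub>3 t"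
  shows "flag_transitive (sym_group n) \<Gamma> {0..n - 3}"
proof -
  \<comment> \<open>Orbits missing \<open>t\<close>: \<open>{a\<^sub>1, a\<^sub>2}\<close> for
    \<open>\<Gamma> 0\<close>, and \<open>{a\<^sub>1}\<close> and
    \<open>{a\<^sub>2, a\<^sub>3}\<close> for \<open>\<Gamma> 1\<close>.\<close>
  define W where "W i = (if i = 0 then {a\<^sub>1, a\<^sub>2} else if i = 1 then {a\<^sub>1, a\<^sub>2, a\<^sub>3} else {a\<^sub>1, a\<^sub>2, a\<^sub>3, t})"
    for i :: nat
  have d1: "distinct [a\<^sub>1, a\<^sub>2, a\<^sub>3, t]" using top_distinct by auto
  note v1 = double_transpose(1-4)[OF d1, folded r1]
  have p1: "\<rho> 1 permutes {a\<^sub>1, a\<^sub>2, a\<^sub>3, t}"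
    using double_transpose(6)[OF d1] unfolding r1 by (simp add: insert_commute)
  have i1: "\<rho> 1 \<circ> \<rho> 1 = id"
    unfolding r1 by (rule double_transpose(5)[OF d1])
  have split1: "transpose a\<^sub>1 a\<^sub>2 \<in> M" "transpose a\<^sub>3 t \<in> M"
    if "subgroup M (sym_group n)" "\<rho> 1 \<in> M" "s \<notin> {a\<^sub>1, a\<^sub>2, a\<^sub>3, t}" "transpose t s \<in> M" for M s
    using split_top[OF that(1,3,4) _ _ that(2)[unfolded r1]] d1 by auto
  have p0: "\<rho> 0 permutes {a\<^sub>1, a\<^sub>2, a\<^sub>3, t}" unfolding r0 by (rule permutes_swap_id) auto
  have i0: "\<rho> 0 \<circ> \<rho> 0 = id" unfolding r0 by simp
  have w0: "\<rho> 0 ` {a\<^sub>1} = {a\<^sub>1}" "\<rho> 0 ` {a\<^sub>1, a\<^sub>2, a\<^sub>3} = {a\<^sub>1, a\<^sub>2, a\<^sub>3}"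
    "\<rho> 0 ` {a\<^sub>2, a\<^sub>3} = {a\<^sub>2, a\<^sub>3}" "\<rho> 0 ` {a\<^sub>1, t} = {a\<^sub>1, t}"
    using top_distinct unfolding r0 by (auto simp: transpose_def)
  have w1: "\<rho> 1 ` {a\<^sub>1, a\<^sub>2} = {a\<^sub>1, a\<^sub>2}" "\<rho> 1 ` {a\<^sub>2, a\<^sub>3} = {a\<^sub>1, t}" "\<rho> 1 ` {a\<^sub>1, t} = {a\<^sub>2, a\<^sub>3}"
    unfolding image_insert image_empty v1 by auto
  have "top_graph n \<rho> \<Gamma> V e t a\<^sub>1 a\<^sub>2 a\<^sub>3 W"
  proof unfold_locales
    show "W i \<subseteq> {a\<^sub>1, a\<^sub>2, a\<^sub>3}" if "i \<in> {0, 1}" for i using that by (auto simp: W_def)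
    show "W 2 = {a\<^sub>1, a\<^sub>2, a\<^sub>3, t}" by (simp add: W_def)
    show "\<rho> i permutes {a\<^sub>1, a\<^sub>2, a\<^sub>3, t}" "\<rho> i \<circ> \<rho> i = id" "\<rho> (1 - i) ` W i = W i" if "i \<in> {0, 1}" for i
      using that p0 p1 i0 i1 w0 w1 by (auto simp: W_def)
    show "transpose x t \<in> M"
      if M: "subgroup M (sym_group n)" "\<rho> 0 \<in> M" "\<rho> 1 \<in> M" "s \<notin> {a\<^sub>1, a\<^sub>2, a\<^sub>3, t}"
          "transpose t s \<in> M"
        and x: "x \<in> {a\<^sub>1, a\<^sub>2, a\<^sub>3}" for M s x
    proof -
      have 3: "transpose a\<^sub>3 t \<in> M" and 12: "transpose a\<^sub>1 a\<^sub>2 \<in> M" using split1[OF M(1,3-5)] by blast+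
      have 2: "transpose a\<^sub>2 t \<in> M" using subgroup_transpose_trans[OF M(1) M(2)[unfolded r0] 3] .
      have "transpose a\<^sub>1 t \<in> M" using subgroup_transpose_trans[OF M(1) 12 2] .
      thus ?thesis using 2 3 x by blast
    qed
    show "transpose x t \<in> M"
      if M: "subgroup M (sym_group n)" "i \<in> {0, 1}" "\<rho> (1 - i) \<in> M" "s \<notin> {a\<^sub>1, a\<^sub>2, a\<^sub>3, t}"
          "transpose t s \<in> M"
        and x: "x \<in> {a\<^sub>1, a\<^sub>2, a\<^sub>3} - W i" for M s x i
    proof -
      have "i = 0" "x = a\<^sub>3" using M(2) x by (auto simp: W_def)
      thus ?thesis using split1[OF M(1) _ M(4,5)] M(3) by simp
    qed
    show "\<exists>\<alpha>\<in>{id, \<rho> 0}. \<exists>\<beta>\<in>{id, \<rho> 1}. \<forall>w\<in>{a\<^sub>1, a\<^sub>2, a\<^sub>3, t}. (\<alpha> \<circ> (b \<circ> a) \<circ> \<beta>) w = w"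
      if a: "a \<in> \<Gamma> 0" and b: "b \<in> \<Gamma> 1" and ba: "b \<circ> a \<in> \<Gamma> 2" for a b
    proof -
      have "b ` {a\<^sub>1} = {a\<^sub>1}" using \<Gamma>_0_1_preserves[of 1 "{a\<^sub>1}" b] b w0(1) by simp
      moreover have "a ` {a\<^sub>1, a\<^sub>2} = {a\<^sub>1, a\<^sub>2}"
        using \<Gamma>_0_1_preserves[of 0 "{a\<^sub>1, a\<^sub>2}" a] a w1(1) by simp
      ultimately have "(b \<circ> a) a\<^sub>1 = a\<^sub>1 \<or> (b \<circ> a) a\<^sub>2 = a\<^sub>1"
        by (intro comp_image_or) simp_all
      moreover have "(`) (b \<circ> a) ` {{a\<^sub>2, a\<^sub>3}, {a\<^sub>1, t}} = {{a\<^sub>2, a\<^sub>3}, {a\<^sub>1, t}}"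
        by (rule \<Gamma>_2_preserves_pair[OF _ _ _ ba]) (unfold w0 w1, simp_all add: insert_commute)
      moreover have "distinct [a\<^sub>1, a\<^sub>2, a\<^sub>3, t]" "{a\<^sub>1, a\<^sub>2, a\<^sub>3, t} = {a\<^sub>1, a\<^sub>2, a\<^sub>3, t}"
        using top_distinct by auto
      ultimately show ?thesis
        using dihedral_factor[of a\<^sub>1 a\<^sub>2 a\<^sub>3 t "b \<circ> a"] unfolding r0 r1 by simp
    qed
  qed
  thus ?thesis by (rule top_graph.flag_transitive_\<Gamma>)
qed

lemma flag_transitive_B:
  assumes r0: "\<rho> 0 = transpose a\<^sub>2 t" and r1: "\<rho> 1 = transpose a\<^sub>1 a\<^sub>2 \<circ> transpose a\<^sub>3 t"
  shows "flag_transitive (sym_group n) \<Gamma> {0..n - 3}"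
proof -
  \<comment> \<open>Now \<open>\<rho> 0\<close> attaches \<open>a\<^sub>2\<close> to
    \<open>t\<close>, so the orbits of \<open>\<Gamma> 1\<close> missing \<open>t\<close> are the
    fixed points \<open>a\<^sub>1\<close> and \<open>a\<^sub>3\<close>.\<close>
  define W where "W i = (if i = 0 then {a\<^sub>1, a\<^sub>2} else if i = 1 then {a\<^sub>1, a\<^sub>3} else {a\<^sub>1, a\<^sub>2, a\<^sub>3, t})"
    for i :: nat
  have d1: "distinct [a\<^sub>1, a\<^sub>2, a\<^sub>3, t]" using top_distinct by auto
  note v1 = double_transpose(1-4)[OF d1, folded r1]
  have p1: "\<rho> 1 permutes {a\<^sub>1, a\<^sub>2, a\<^sub>3, t}"
    using double_transpose(6)[OF d1] unfolding r1 by (simp add: insert_commute)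
  have i1: "\<rho> 1 \<circ> \<rho> 1 = id"
    unfolding r1 by (rule double_transpose(5)[OF d1])
  have split1: "transpose a\<^sub>1 a\<^sub>2 \<in> M" "transpose a\<^sub>3 t \<in> M"
    if "subgroup M (sym_group n)" "\<rho> 1 \<in> M" "s \<notin> {a\<^sub>1, a\<^sub>2, a\<^sub>3, t}" "transpose t s \<in> M" for M s
    using split_top[OF that(1,3,4) _ _ that(2)[unfolded r1]] d1 by auto
  have p0: "\<rho> 0 permutes {a\<^sub>1, a\<^sub>2, a\<^sub>3, t}" unfolding r0 by (rule permutes_swap_id) auto
  have i0: "\<rho> 0 \<circ> \<rho> 0 = id" unfolding r0 by simp
  have w0: "\<rho> 0 ` {a\<^sub>1} = {a\<^sub>1}" "\<rho> 0 ` {a\<^sub>1, a\<^sub>3} = {a\<^sub>1, a\<^sub>3}" "\<rho> 0 ` {a\<^sub>2, t} = {a\<^sub>2, t}"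
    using top_distinct unfolding r0 by (auto simp: transpose_def)
  have w1: "\<rho> 1 ` {a\<^sub>1, a\<^sub>2} = {a\<^sub>1, a\<^sub>2}" "\<rho> 1 ` {a\<^sub>2, t} = {a\<^sub>1, a\<^sub>3}" "\<rho> 1 ` {a\<^sub>1, a\<^sub>3} = {a\<^sub>2, t}"
    unfolding image_insert image_empty v1 by auto
  have "top_graph n \<rho> \<Gamma> V e t a\<^sub>1 a\<^sub>2 a\<^sub>3 W"
  proof unfold_locales
    show "W i \<subseteq> {a\<^sub>1, a\<^sub>2, a\<^sub>3}" if "i \<in> {0, 1}" for i using that by (auto simp: W_def)
    show "W 2 = {a\<^sub>1, a\<^sub>2, a\<^sub>3, t}" by (simp add: W_def)
    show "\<rho> i permutes {a\<^sub>1, a\<^sub>2, a\<^sub>3, t}" "\<rho> i \<circ> \<rho> i = id" "\<rho> (1 - i) ` W i = W i" if "i \<in> {0, 1}" for i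
      using that p0 p1 i0 i1 w0 w1 by (auto simp: W_def)
    show "transpose x t \<in> M"
      if M: "subgroup M (sym_group n)" "\<rho> 0 \<in> M" "\<rho> 1 \<in> M" "s \<notin> {a\<^sub>1, a\<^sub>2, a\<^sub>3, t}"
          "transpose t s \<in> M"
        and x: "x \<in> {a\<^sub>1, a\<^sub>2, a\<^sub>3}" for M s x
    proof -
      have 3: "transpose a\<^sub>3 t \<in> M" and 12: "transpose a\<^sub>1 a\<^sub>2 \<in> M" using split1[OF M(1,3-5)] by blast+
      have 2: "transpose a\<^sub>2 t \<in> M" using M(2) unfolding r0 .
      have "transpose a\<^sub>1 t \<in> M" using subgroup_transpose_trans[OF M(1) 12 2] .
      thus ?thesis using 2 3 x by blast
    qed
    show "transpose x t \<in> M"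
      if M: "subgroup M (sym_group n)" "i \<in> {0, 1}" "\<rho> (1 - i) \<in> M" "s \<notin> {a\<^sub>1, a\<^sub>2, a\<^sub>3, t}"
          "transpose t s \<in> M"
        and x: "x \<in> {a\<^sub>1, a\<^sub>2, a\<^sub>3} - W i" for M s x i
    proof -
      have "i = 0 \<and> x = a\<^sub>3 \<or> i = 1 \<and> x = a\<^sub>2" using M(2) x by (auto simp: W_def)
      thus ?thesis using split1[OF M(1) _ M(4,5)] M(3) r0 by auto
    qed
    show "\<exists>\<alpha>\<in>{id, \<rho> 0}. \<exists>\<beta>\<in>{id, \<rho> 1}. \<forall>w\<in>{a\<^sub>1, a\<^sub>2, a\<^sub>3, t}. (\<alpha> \<circ> (b \<circ> a) \<circ> \<beta>) w = w"
      if a: "a \<in> \<Gamma> 0" and b: "b \<in> \<Gamma> 1" and ba: "b \<circ> a \<in> \<Gamma> 2" for a b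
    proof -
      have "b ` {a\<^sub>1} = {a\<^sub>1}" using \<Gamma>_0_1_preserves[of 1 "{a\<^sub>1}" b] b w0(1) by simp
      moreover have "a ` {a\<^sub>1, a\<^sub>2} = {a\<^sub>1, a\<^sub>2}"
        using \<Gamma>_0_1_preserves[of 0 "{a\<^sub>1, a\<^sub>2}" a] a w1(1) by simp
      ultimately have "(b \<circ> a) a\<^sub>1 = a\<^sub>1 \<or> (b \<circ> a) a\<^sub>2 = a\<^sub>1"
        by (intro comp_image_or) simp_all
      moreover have "(`) (b \<circ> a) ` {{a\<^sub>2, t}, {a\<^sub>1, a\<^sub>3}} = {{a\<^sub>2, t}, {a\<^sub>1, a\<^sub>3}}"
        by (rule \<Gamma>_2_preserves_pair[OF _ _ _ ba]) (unfold w0 w1, simp_all add: insert_commute)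
      \<comment> \<open>In this type \<open>t\<close> is an inner vertex of the path, so the
        dihedral lemma is applied in this order.\<close>
      moreover have "distinct [a\<^sub>1, a\<^sub>2, t, a\<^sub>3]" "{a\<^sub>1, a\<^sub>2, t, a\<^sub>3} = {a\<^sub>1, a\<^sub>2, a\<^sub>3, t}"
        using top_distinct by auto
      ultimately show ?thesis
        using dihedral_factor[of a\<^sub>1 a\<^sub>2 t a\<^sub>3 "b \<circ> a"]
        unfolding r0 r1 by (simp only: transpose_commute[of t] insert_commute[of t])
    qed
  qed
  thus ?thesis by (rule top_graph.flag_transitive_\<Gamma>)
qed

text \<open>Here the edges with labels 0 and 1 form a 4-cycle, so \<open>\<rho> 0\<close> and
  \<open>\<rho> 1\<close> commute and every permutation induced by \<open>\<Gamma> 2\<close> on the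
  four points is already a product of the required form.\<close>

lemma flag_transitive_C:
  assumes r0: "\<rho> 0 = transpose a\<^sub>1 a\<^sub>2 \<circ> transpose a\<^sub>3 t" and r1: "\<rho> 1 = transpose a\<^sub>1 a\<^sub>3 \<circ> transpose a\<^sub>2 t"
  shows "flag_transitive (sym_group n) \<Gamma> {0..n - 3}"
proof -
  define W where "W i = (if i = 0 then {a\<^sub>1, a\<^sub>3} else if i = 1 then {a\<^sub>1, a\<^sub>2} else {a\<^sub>1, a\<^sub>2, a\<^sub>3, t})"
    for i :: nat
  have d0: "distinct [a\<^sub>1, a\<^sub>2, a\<^sub>3, t]" using top_distinct by auto
  note v0 = double_transpose(1-4)[OF d0, folded r0]
  have p0: "\<rho> 0 permutes {a\<^sub>1, a\<^sub>2, a\<^sub>3, t}"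
    using double_transpose(6)[OF d0] unfolding r0 by (simp add: insert_commute)
  have i0: "\<rho> 0 \<circ> \<rho> 0 = id"
    unfolding r0 by (rule double_transpose(5)[OF d0])
  have split0: "transpose a\<^sub>1 a\<^sub>2 \<in> M" "transpose a\<^sub>3 t \<in> M"
    if "subgroup M (sym_group n)" "\<rho> 0 \<in> M" "s \<notin> {a\<^sub>1, a\<^sub>2, a\<^sub>3, t}" "transpose t s \<in> M" for M s
    using split_top[OF that(1,3,4) _ _ that(2)[unfolded r0]] d0 by auto
  have d1: "distinct [a\<^sub>1, a\<^sub>3, a\<^sub>2, t]" using top_distinct by auto
  note v1 = double_transpose(1-4)[OF d1, folded r1]
  have p1: "\<rho> 1 permutes {a\<^sub>1, a\<^sub>2, a\<^sub>3, t}"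
    using double_transpose(6)[OF d1] unfolding r1 by (simp add: insert_commute)
  have i1: "\<rho> 1 \<circ> \<rho> 1 = id"
    unfolding r1 by (rule double_transpose(5)[OF d1])
  have split1: "transpose a\<^sub>1 a\<^sub>3 \<in> M" "transpose a\<^sub>2 t \<in> M"
    if "subgroup M (sym_group n)" "\<rho> 1 \<in> M" "s \<notin> {a\<^sub>1, a\<^sub>2, a\<^sub>3, t}" "transpose t s \<in> M" for M s
    using split_top[OF that(1,3,4) _ _ that(2)[unfolded r1]] d1 by auto
  have w0: "\<rho> 0 ` {a\<^sub>1, a\<^sub>2} = {a\<^sub>1, a\<^sub>2}" "\<rho> 0 ` {a\<^sub>3, t} = {a\<^sub>3, t}"
    "\<rho> 0 ` {a\<^sub>1, a\<^sub>3} = {a\<^sub>2, t}" "\<rho> 0 ` {a\<^sub>2, t} = {a\<^sub>1, a\<^sub>3}"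
    unfolding image_insert image_empty v0 by auto
  have w1: "\<rho> 1 ` {a\<^sub>1, a\<^sub>3} = {a\<^sub>1, a\<^sub>3}" "\<rho> 1 ` {a\<^sub>2, t} = {a\<^sub>2, t}"
    "\<rho> 1 ` {a\<^sub>1, a\<^sub>2} = {a\<^sub>3, t}" "\<rho> 1 ` {a\<^sub>3, t} = {a\<^sub>1, a\<^sub>2}"
    unfolding image_insert image_empty v1 by auto
  have "top_graph n \<rho> \<Gamma> V e t a\<^sub>1 a\<^sub>2 a\<^sub>3 W"
  proof unfold_locales
    show "W i \<subseteq> {a\<^sub>1, a\<^sub>2, a\<^sub>3}" if "i \<in> {0, 1}" for i using that by (auto simp: W_def)
    show "W 2 = {a\<^sub>1, a\<^sub>2, a\<^sub>3, t}" by (simp add: W_def)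
    show "\<rho> i permutes {a\<^sub>1, a\<^sub>2, a\<^sub>3, t}" "\<rho> i \<circ> \<rho> i = id" "\<rho> (1 - i) ` W i = W i" if "i \<in> {0, 1}" for i
      using that p0 p1 i0 i1 w0 w1 by (auto simp: W_def)
    show "transpose x t \<in> M"
      if M: "subgroup M (sym_group n)" "\<rho> 0 \<in> M" "\<rho> 1 \<in> M" "s \<notin> {a\<^sub>1, a\<^sub>2, a\<^sub>3, t}"
          "transpose t s \<in> M"
        and x: "x \<in> {a\<^sub>1, a\<^sub>2, a\<^sub>3}" for M s x
    proof -
      have 3: "transpose a\<^sub>3 t \<in> M" and 12: "transpose a\<^sub>1 a\<^sub>2 \<in> M" using split0[OF M(1,2,4,5)] by blast+
      have 2: "transpose a\<^sub>2 t \<in> M" using split1[OF M(1,3-5)] by blast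
      have "transpose a\<^sub>1 t \<in> M" using subgroup_transpose_trans[OF M(1) 12 2] .
      thus ?thesis using 2 3 x by blast
    qed
    show "transpose x t \<in> M"
      if M: "subgroup M (sym_group n)" "i \<in> {0, 1}" "\<rho> (1 - i) \<in> M" "s \<notin> {a\<^sub>1, a\<^sub>2, a\<^sub>3, t}"
          "transpose t s \<in> M"
        and x: "x \<in> {a\<^sub>1, a\<^sub>2, a\<^sub>3} - W i" for M s x i
    proof -
      have "i = 0 \<and> x = a\<^sub>2 \<or> i = 1 \<and> x = a\<^sub>3" using M(2) x by (auto simp: W_def)
      thus ?thesis using split0[OF M(1) _ M(4,5)] split1[OF M(1) _ M(4,5)] M(3) by auto
    qed
    show "\<exists>\<alpha>\<in>{id, \<rho> 0}. \<exists>\<beta>\<in>{id, \<rho> 1}. \<forall>w\<in>{a\<^sub>1, a\<^sub>2, a\<^sub>3, t}. (\<alpha> \<circ> (b \<circ> a) \<circ> \<beta>) w = w"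
      if a: "a \<in> \<Gamma> 0" and b: "b \<in> \<Gamma> 1" and ba: "b \<circ> a \<in> \<Gamma> 2" for a b
    proof -
      have "(`) (b \<circ> a) ` {{a\<^sub>1, a\<^sub>2}, {a\<^sub>3, t}} = {{a\<^sub>1, a\<^sub>2}, {a\<^sub>3, t}}"
        by (rule \<Gamma>_2_preserves_pair[OF _ _ _ ba]) (unfold w0 w1, simp_all add: insert_commute)
      moreover have "(`) (b \<circ> a) ` {{a\<^sub>1, a\<^sub>3}, {a\<^sub>2, t}} = {{a\<^sub>1, a\<^sub>3}, {a\<^sub>2, t}}"
        by (rule \<Gamma>_2_preserves_pair[OF _ _ _ ba]) (unfold w0 w1, simp_all add: insert_commute)
      ultimately show ?thesis
        unfolding r0 r1 by (rule klein_factor[OF top_distinct])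
    qed
  qed
  thus ?thesis by (rule top_graph.flag_transitive_\<Gamma>)
qed

end

section \<open>From the edge-labelled graph to transpositions\<close>

lemma involution_one_edge:
  assumes "involution_in (sym_group n) (\<rho> i)" "perm_rep_graph n \<rho> i = {{x, y}}"
    and "x \<in> {1..n}" "y \<in> {1..n}" "x \<noteq> y"
  shows "\<rho> i = transpose x y"
  using perm_rep_graph_one_edge[where \<rho> = \<rho> and i = i, OF assms(1,3-5)] assms(2) by simp

lemma tree_part_imp_tree_graph:
  assumes n: "n \<ge> 5" and inv: "\<And>i. i \<in> {0..n - 3} \<Longrightarrow> involution_in (sym_group n) (\<rho> i)"
    and part: "tree_part n (perm_rep_graph n \<rho>) t a\<^sub>1 a\<^sub>2 a\<^sub>3"
    and \<Gamma>: "\<And>i. i \<in> {0..n - 3} \<Longrightarrow> \<Gamma> i = generate (sym_group n) {\<rho> j | j. j \<in> {0..n - 3} \<and> j \<noteq> i}"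
  obtains V e where "tree_graph n \<rho> \<Gamma> V e t a\<^sub>1 a\<^sub>2 a\<^sub>3"
proof -
  obtain V E e where V: "V \<subseteq> {1..n}" "card V = n - 3"
    and tree: "graph_tree V E" and e: "bij_betw e {2..n - 3} E"
    and edges: "\<forall>k\<in>{2..n - 3}. perm_rep_graph n \<rho> k = {e k}"
    and t: "graph_leaf V E t" "t \<in> e 2" and compl: "{1..n} - V = {a\<^sub>1, a\<^sub>2, a\<^sub>3}"
    using part unfolding tree_part_def by (elim exE conjE) (rule that)
  have E: "E = e ` {2..n - 3}" and inj: "inj_on e {2..n - 3}"
    using e by (auto simp: bij_betw_def)
  have "tree_graph n \<rho> \<Gamma> V e t a\<^sub>1 a\<^sub>2 a\<^sub>3"
  proof
    have "card ({1..n} - V) = 3"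
      using V(1,2) n by (simp add: card_Diff_subset finite_subset[OF V(1)])
    hence "card {a\<^sub>1, a\<^sub>2, a\<^sub>3} = 3" using compl by simp
    thus "distinct [a\<^sub>1, a\<^sub>2, a\<^sub>3]"
      by (cases "a\<^sub>1 = a\<^sub>2"; cases "a\<^sub>1 = a\<^sub>3"; cases "a\<^sub>2 = a\<^sub>3") (simp_all add: card_insert_if)
    show "\<exists>x\<in>V. \<exists>y\<in>V. x \<noteq> y \<and> e k = {x, y} \<and> \<rho> k = transpose x y" if k: "k \<in> {2..n - 3}" for k
    proof -
      have "e k \<subseteq> V" "card (e k) = 2"
        using tree k E unfolding graph_tree_def simple_graph_def by auto
      then obtain x y where xy: "e k = {x, y}" "x \<noteq> y" "x \<in> V" "y \<in> V"
        by (auto simp: card_2_iff)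
      have "\<rho> k = transpose x y"
        using inv[of k] edges[rule_format, OF k] xy V(1) k by (intro involution_one_edge) auto
      thus ?thesis using xy by blast
    qed
    show "(u, v) \<in> {(x, y). {x, y} \<in> e ` {2..n - 3}}\<^sup>*" if "u \<in> V" "v \<in> V" for u v
      using tree that unfolding graph_tree_def graph_connected_def E by blast
    show "t \<in> V" using t(1) unfolding graph_leaf_def by blast
    show "t \<in> e k \<longleftrightarrow> k = 2" if k: "k \<in> {2..n - 3}" for k
    proof
      assume tk: "t \<in> e k"
      \<comment> \<open>A leaf lies on a single edge, so \<open>e k\<close> and \<open>e 2\<close>
        coincide, and injectivity of the labelling identifies the labels.\<close>
      obtain f where f: "{f \<in> E. t \<in> f} = {f}"
        using t(1) unfolding graph_leaf_def by (auto simp: card_1_singleton_iff)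
      have 2: "2 \<in> {2..n - 3}" using n by simp
      have "e k \<in> {f \<in> E. t \<in> f}" "e 2 \<in> {f \<in> E. t \<in> f}" using tk t(2) k 2 E by auto
      hence "e k = e 2" using f by simp
      thus "k = 2" using inj_onD[OF inj] k 2 by blast
    qed (use t(2) in simp)
    show "\<rho> i permutes {1..n}" if "i \<in> {0, 1}" for i
      using inv[of i] that n by (auto simp: involution_in_def sym_group_carrier)
  qed (use n V compl \<Gamma> in auto)
  thus thesis by (rule that)
qed

theorem theorem6p6:
  fixes n :: nat and \<rho> :: "nat \<Rightarrow> nat \<Rightarrow> nat" and \<Gamma> :: "nat \<Rightarrow> (nat \<Rightarrow> nat) set"
  assumes "n \<ge> 9"
    and "\<And>i. i \<in> {0..n - 3} \<Longrightarrow> involution_in (sym_group n) (\<rho> i)"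
    and "type_A n (perm_rep_graph n \<rho>) \<or> type_B n (perm_rep_graph n \<rho>)
         \<or> type_C n (perm_rep_graph n \<rho>)"
    and "\<And>i. i \<in> {0..n - 3} \<Longrightarrow> \<Gamma> i = generate (sym_group n) {\<rho> j | j. j \<in> {0..n - 3} \<and> j \<noteq> i}"
  shows "flag_transitive (sym_group n) \<Gamma> {0..n - 3}"
proof -
  note n = assms(1) and inv = assms(2) and \<Gamma> = assms(4)
  have n5: "n \<ge> 5" using n by simp
  have inv01: "involution_in (sym_group n) (\<rho> 0)" "involution_in (sym_group n) (\<rho> 1)"
    using inv n by auto
  let ?G = "perm_rep_graph n \<rho>"
  have tree: "\<exists>V e. tree_graph n \<rho> \<Gamma> V e t a\<^sub>1 a\<^sub>2 a\<^sub>3 \<and>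
      distinct [a\<^sub>1, a\<^sub>2, a\<^sub>3, t] \<and> {a\<^sub>1, a\<^sub>2, a\<^sub>3, t} \<subseteq> {1..n}"
    if part: "tree_part n ?G t a\<^sub>1 a\<^sub>2 a\<^sub>3" for t a\<^sub>1 a\<^sub>2 a\<^sub>3
  proof -
    obtain V e where T: "tree_graph n \<rho> \<Gamma> V e t a\<^sub>1 a\<^sub>2 a\<^sub>3"
      by (rule tree_part_imp_tree_graph[OF n5 inv part \<Gamma>])
    have "{a\<^sub>1, a\<^sub>2, a\<^sub>3, t} \<subseteq> {1..n}"
      using tree_graph.V[OF T] tree_graph.t[OF T] by auto
    thus ?thesis using T tree_graph.top_distinct[OF T] by blast
  qed
  have one: "\<rho> 0 = transpose x y" if "?G 0 = {{x, y}}" "{x, y} \<subseteq> {1..n}" "x \<noteq> y" for x y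
    using that inv01(1) by (intro involution_one_edge) auto
  have two: "\<rho> i = transpose x y \<circ> transpose z w"
    if "?G i = {{x, y}, {z, w}}" "i \<in> {0, 1}" "{x, y, z, w} \<subseteq> {1..n}" "distinct [x, y, z, w]"
    for i x y z w
    using that inv01 perm_rep_graph_two_edges[of n \<rho> i x y z w] by auto
  consider (A) "type_A n ?G" | (B) "type_B n ?G" | (C) "type_C n ?G" using assms(3) by blast
  thus ?thesis
  proof cases
    case A
    then obtain t a\<^sub>1 a\<^sub>2 a\<^sub>3 where *: "tree_part n ?G t a\<^sub>1 a\<^sub>2 a\<^sub>3"
      "?G 0 = {{a\<^sub>2, a\<^sub>3}}" "?G 1 = {{a\<^sub>1, a\<^sub>2}, {a\<^sub>3, t}}"
      unfolding type_A_def by (elim exE conjE) (rule that)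
    obtain V e where T: "tree_graph n \<rho> \<Gamma> V e t a\<^sub>1 a\<^sub>2 a\<^sub>3"
      and d: "distinct [a\<^sub>1, a\<^sub>2, a\<^sub>3, t]" "{a\<^sub>1, a\<^sub>2, a\<^sub>3, t} \<subseteq> {1..n}"
      using tree[OF *(1)] by (elim exE conjE) (rule that)
    show ?thesis
    proof (rule tree_graph.flag_transitive_A[OF T])
      show "\<rho> 0 = transpose a\<^sub>2 a\<^sub>3" by (rule one[OF *(2)]) (use d in auto)
      show "\<rho> 1 = transpose a\<^sub>1 a\<^sub>2 \<circ> transpose a\<^sub>3 t" by (rule two[OF *(3)]) (use d in auto)
    qed
  next
    case B
    then obtain t a\<^sub>1 a\<^sub>2 a\<^sub>3 where *: "tree_part n ?G t a\<^sub>1 a\<^sub>2 a\<^sub>3"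
      "?G 0 = {{a\<^sub>2, t}}" "?G 1 = {{a\<^sub>1, a\<^sub>2}, {t, a\<^sub>3}}"
      unfolding type_B_def by (elim exE conjE) (rule that)
    obtain V e where T: "tree_graph n \<rho> \<Gamma> V e t a\<^sub>1 a\<^sub>2 a\<^sub>3"
      and d: "distinct [a\<^sub>1, a\<^sub>2, a\<^sub>3, t]" "{a\<^sub>1, a\<^sub>2, a\<^sub>3, t} \<subseteq> {1..n}"
      using tree[OF *(1)] by (elim exE conjE) (rule that)
    show ?thesis
    proof (rule tree_graph.flag_transitive_B[OF T])
      show "\<rho> 0 = transpose a\<^sub>2 t" by (rule one[OF *(2)]) (use d in auto)
      have "\<rho> 1 = transpose a\<^sub>1 a\<^sub>2 \<circ> transpose t a\<^sub>3" by (rule two[OF *(3)]) (use d in auto)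
      thus "\<rho> 1 = transpose a\<^sub>1 a\<^sub>2 \<circ> transpose a\<^sub>3 t" by (simp only: transpose_commute[of t])
    qed
  next
    case C
    then obtain t a\<^sub>1 a\<^sub>2 a\<^sub>3 where *: "tree_part n ?G t a\<^sub>1 a\<^sub>2 a\<^sub>3"
      "?G 0 = {{a\<^sub>1, a\<^sub>2}, {a\<^sub>3, t}}" "?G 1 = {{a\<^sub>1, a\<^sub>3}, {a\<^sub>2, t}}"
      unfolding type_C_def by (elim exE conjE) (rule that)
    obtain V e where T: "tree_graph n \<rho> \<Gamma> V e t a\<^sub>1 a\<^sub>2 a\<^sub>3"
      and d: "distinct [a\<^sub>1, a\<^sub>2, a\<^sub>3, t]" "{a\<^sub>1, a\<^sub>2, a\<^sub>3, t} \<subseteq> {1..n}"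
      using tree[OF *(1)] by (elim exE conjE) (rule that)
    show ?thesis
    proof (rule tree_graph.flag_transitive_C[OF T])
      show "\<rho> 0 = transpose a\<^sub>1 a\<^sub>2 \<circ> transpose a\<^sub>3 t" by (rule two[OF *(2)]) (use d in auto)
      show "\<rho> 1 = transpose a\<^sub>1 a\<^sub>3 \<circ> transpose a\<^sub>2 t" by (rule two[OF *(3)]) (use d in auto)
    qed
  qed
qed

end
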